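(* Let $p(x|\theta,\tau)$ be a statistical model with parameters $(\theta,\tau)=(\theta_1,\ldots,\theta_{d_1},\tau_1,\ldots,\tau_{d_2})$ ($d_1\ge 1$, $d_2\ge 0$) realizing the true distribution $q$ at the origin, with log-likelihood ratio $f$ and Kullback–Leibler divergence $K$, under the standing assumptions of the context. Let $1\le r\le d_1$ and $m\ge 1$ be integers, and let $U\subset\mathbb{R}^{d_2}$ be a sufficiently small neighborhood of $\tau=0$. Assume: (0) for every $\tau\in U$, $f(X|\theta=0,\tau)=0$ a.s. (if $d_2=0$ this condition is automatically regarded as satisfied); (1) the $r$ random variables $\left.\frac{\partial f(X|\theta,\tau)}{\partial\theta_1}\right|_{(\theta,\tau)=0},\ldots,\left.\frac{\partial f(X|\theta,\tau)}{\partial\theta_r}\right|_{(\theta,\tau)=0}$ are linearly independent over $\mathbb{R}$; (2) for every $\tau\in U$, $F_1(X|\theta_{r+1},\ldots,\theta_{d_1})=\cdots=F_{m-1}(X|\theta_{r+1},\ldots,\theta_{d_1})=0$ a.s. (identically in $\theta_{r+1},\ldots,\theta_{d_1}$), and $m$ is the largest integer with this property; by convention $m=1$ means $r=d_1$. Then, treating $\tau$ as an arbitrary constant in a neighborhood of $\tau=0$, the Taylor expansion of $K(\theta,\tau)$ in $\theta$ at $\theta=0$ has the form $$K(\theta,\tau)=\frac12\,\mathbb{E}_X\!\left[\left\{F_1(X|\theta_1,\ldots,\theta_r)+F_m(X|\theta_{r+1},\ldots,\theta_{d_1})\right\}^2\right]+R(\theta,\tau),$$ where all coefficients may depend on $\tau$,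 and where the expansion of the remainder $R$ (the "higher order terms") contains none of the following kinds of monomials in $\theta$: - monomials of degree at most $2m$ involving only $\theta_{r+1},\ldots,\theta_{d_1}$; - monomials of degree exactly one in $(\theta_1,\ldots,\theta_r)$ and of degree at most $m$ in $(\theta_{r+1},\ldots,\theta_{d_1})$; - monomials of degree two involving only $\theta_1,\ldots,\theta_r$.
   Context: Setting. $p(x|\theta,\tau)$, $x\in\chi$, is a family of probability densities with respect to a fixed measure on $\chi$, with $(\theta,\tau)$ in a set $\Theta\subset\mathbb{R}^{d_1+d_2}$ containing a neighborhood of the origin. $q$ is the true density, and $q(x)=p(x|0,0)$ a.s. (realizability at the origin). $X$ is a random variable with density $q$, and $\mathbb{E}_X$ is expectation with respect to $X$. Define $$f(x|\theta,\tau):=\log\frac{q(x)}{p(x|\theta,\tau)},\qquad K(\theta,\tau):=\mathbb{E}_X[f(X|\theta,\tau)].$$ Standing assumptions: $K$ is real analytic around the origin; $f$ is square integrable and analytic (as an $L^2$-function) in the parameters around the origin; taking expectations and taking partial derivatives with respect to the parameters may be interchanged. Notation. For a subset of the coordinates, say $\theta_a,\ldots,\theta_b$, and $\tau$ regarded as a constant, $F_k(x|\theta_a,\ldots,\theta_b)$ denotes the homogeneous degree-$k$ part of the Taylor expansion of $f(x|\theta,\tau)$ at $\theta=0$ in those coordinates only: $$F_k(x|\theta_a,\ldots,\theta_b):=\sum_{i_a+\cdots+i_b=k}\frac{1}{i_a!\cdots i_b!}\left.\frac{\partial^k f(x|\theta,\tau)}{\partial\theta_a^{i_a}\cdots\partial\theta_b^{i_b}}\right|_{\theta=0}\theta_a^{i_a}\cdots\theta_b^{i_b}.$$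 It depends on $\tau$. If $r=d_1$ there are no coordinates $\theta_{r+1},\ldots,\theta_{d_1}$, and $F_m(x|\theta_{r+1},\ldots,\theta_{d_1})$ is read as $0$.
   Formalization: Added: outside a null set independent of the parameters, p(x|θ,τ)>0 exactly where q(x)>0; without it the claim fails. f is read as the pointwise sum of its L² power series, and interchange is assumed for p/q as well as for f. *)

theory Defs
  imports "HOL-Probability.Probability"
begin

section \<open>Vectors, multi-indices and Taylor expansions\<close>

text \<open>
  The space \<open>\<real>\<^sup>d\<close> (with \<open>d = 0\<close> allowed) is the set of sequences that vanish from index \<open>d\<close> on;
  coordinates are counted from \<open>0\<close>, so the \<open>i\<close>-th coordinate of the literature is \<open>v (i - 1)\<close>.
\<close>

definition vecs :: "nat \<Rightarrow> (nat \<Rightarrow> real) set" where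
  "vecs d = {v. \<forall>i\<ge>d. v i = 0}"

definition cube :: "nat \<Rightarrow> real \<Rightarrow> (nat \<Rightarrow> real) set" where
  "cube d \<epsilon> = {v \<in> vecs d. \<forall>i<d. \<bar>v i\<bar> < \<epsilon>}"

definition nbhd0 :: "nat \<Rightarrow> (nat \<Rightarrow> real) set \<Rightarrow> bool" where
  "nbhd0 d S \<longleftrightarrow> S \<subseteq> vecs d \<and> (\<exists>\<epsilon>>0. cube d \<epsilon> \<subseteq> S)"

text \<open>The parameter \<open>(\<theta>, \<tau>) \<in> \<real>\<^sup>d\<^sup>1 \<times> \<real>\<^sup>d\<^sup>2\<close> as a vector of length \<open>d1 + d2\<close>.\<close>

definition joint :: "nat \<Rightarrow> (nat \<Rightarrow> real) \<Rightarrow> (nat \<Rightarrow> real) \<Rightarrow> nat \<Rightarrow> real" where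
  "joint d1 \<theta> \<tau> = (\<lambda>i. if i < d1 then \<theta> i else \<tau> (i - d1))"

definition multi_indices :: "nat set \<Rightarrow> (nat \<Rightarrow> nat) set" where
  "multi_indices J = {\<alpha>. \<forall>i. i \<notin> J \<longrightarrow> \<alpha> i = 0}"

definition monomial :: "nat set \<Rightarrow> (nat \<Rightarrow> nat) \<Rightarrow> (nat \<Rightarrow> real) \<Rightarrow> real" where
  "monomial J \<alpha> v = (\<Prod>i\<in>J. v i ^ \<alpha> i)"

definition partial :: "nat \<Rightarrow> ((nat \<Rightarrow> real) \<Rightarrow> real) \<Rightarrow> (nat \<Rightarrow> real) \<Rightarrow> real" where
  "partial i g v = deriv (\<lambda>t. g (v(i := t))) (v i)"

text \<open>
  Iterated partial derivative of multi-order \<open>\<alpha>\<close> in the coordinates of the finite set \<open>J\<close>.  A fixed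
  order of differentiation is used; it is irrelevant for the analytic functions considered below.
\<close>

definition mixed_partial ::
  "nat set \<Rightarrow> (nat \<Rightarrow> nat) \<Rightarrow> ((nat \<Rightarrow> real) \<Rightarrow> real) \<Rightarrow> (nat \<Rightarrow> real) \<Rightarrow> real" where
  "mixed_partial J \<alpha> g = fold (\<lambda>i. partial i ^^ \<alpha> i) (sorted_list_of_set J) g"

text \<open>
  The homogeneous part of degree \<open>k\<close> of the Taylor expansion of \<open>g\<close> at \<open>v\<close> in the coordinates \<open>J\<close>
  only, evaluated at the increment \<open>\<theta>\<close>.  It is \<open>0\<close> for \<open>J = {}\<close> and \<open>k \<ge> 1\<close>.
\<close>

definition taylor_part ::
  "nat set \<Rightarrow> nat \<Rightarrow> ((nat \<Rightarrow> real) \<Rightarrow> real) \<Rightarrow> (nat \<Rightarrow> real) \<Rightarrow> (nat \<Rightarrow> real) \<Rightarrow> real" where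
  "taylor_part J k g v \<theta> =
     (\<Sum>\<alpha> \<in> {\<alpha> \<in> multi_indices J. sum \<alpha> J = k}.
        1 / (\<Prod>i\<in>J. fact (\<alpha> i)) * mixed_partial J \<alpha> g v * monomial J \<alpha> \<theta>)"

definition real_analytic_at_0 :: "nat \<Rightarrow> ((nat \<Rightarrow> real) \<Rightarrow> real) \<Rightarrow> bool" where
  "real_analytic_at_0 d g \<longleftrightarrow>
     (\<exists>\<rho>>0. \<exists>a. \<forall>w\<in>cube d \<rho>.
        ((\<lambda>\<alpha>. a \<alpha> * monomial {..<d} \<alpha> w) has_sum g w) (multi_indices {..<d}))"


section \<open>Random functions of the parameter\<close>

definition square_integrable :: "'w measure \<Rightarrow> ('w \<Rightarrow> real) \<Rightarrow> bool" where
  "square_integrable P Y \<longleftrightarrow> Y \<in> borel_measurable P \<and> integrable P (\<lambda>\<omega>. (Y \<omega>)\<^sup>2)"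

text \<open>
  Analyticity at the origin as an \<open>L\<^sup>2\<close>-valued function of the parameter: a power series with
  coefficients in \<open>L\<^sup>2\<close> that converges absolutely in the \<open>L\<^sup>2\<close>-norm.  Such a series also converges
  absolutely pointwise, outside a null set that does not depend on the parameter.  The random
  function is required to be the version given by this pointwise sum, so that its pointwise partial
  derivatives in the parameter exist almost surely (and agree with the \<open>L\<^sup>2\<close>-derivatives).
\<close>

definition L2_analytic_at_0 :: "'w measure \<Rightarrow> nat \<Rightarrow> ('w \<Rightarrow> (nat \<Rightarrow> real) \<Rightarrow> real) \<Rightarrow> bool" where
  "L2_analytic_at_0 P d g \<longleftrightarrow>
     (\<exists>\<rho>>0. \<exists>a.
        (\<forall>\<alpha>\<in>multi_indices {..<d}. square_integrable P (a \<alpha>)) \<and>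
        (\<lambda>\<alpha>. sqrt (\<integral>\<omega>. (a \<alpha> \<omega>)\<^sup>2 \<partial>P) * \<rho> ^ sum \<alpha> {..<d}) summable_on multi_indices {..<d} \<and>
        (AE \<omega> in P. \<forall>w\<in>cube d \<rho>.
           ((\<lambda>\<alpha>. a \<alpha> \<omega> * monomial {..<d} \<alpha> w) has_sum g \<omega> w) (multi_indices {..<d})))"

definition interchangeable :: "'w measure \<Rightarrow> nat \<Rightarrow> ('w \<Rightarrow> (nat \<Rightarrow> real) \<Rightarrow> real) \<Rightarrow> bool" where
  "interchangeable P d g \<longleftrightarrow>
     (\<exists>\<rho>>0. \<forall>w\<in>cube d \<rho>. \<forall>\<alpha>\<in>multi_indices {..<d}.
        integrable P (\<lambda>\<omega>. mixed_partial {..<d} \<alpha> (g \<omega>) w) \<and>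
        mixed_partial {..<d} \<alpha> (\<lambda>w. \<integral>\<omega>. g \<omega> w \<partial>P) w =
          (\<integral>\<omega>. mixed_partial {..<d} \<alpha> (g \<omega>) w \<partial>P))"

text \<open>Linear independence over \<open>\<real>\<close> of random variables, i.e. modulo almost sure equality.\<close>

definition lin_indep_rvs :: "'w measure \<Rightarrow> nat \<Rightarrow> (nat \<Rightarrow> 'w \<Rightarrow> real) \<Rightarrow> bool" where
  "lin_indep_rvs P r Y \<longleftrightarrow>
     (\<forall>c :: nat \<Rightarrow> real. (AE \<omega> in P. (\<Sum>i<r. c i * Y i \<omega>) = 0) \<longrightarrow> (\<forall>i<r. c i = 0))"


section \<open>The statistical model\<close>

definition llr :: "('x \<Rightarrow> (nat \<Rightarrow> real) \<Rightarrow> real) \<Rightarrow> ('x \<Rightarrow> real) \<Rightarrow> 'x \<Rightarrow> (nat \<Rightarrow> real) \<Rightarrow> real" where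
  "llr p q x w = ln (q x / p x w)"

definition KL :: "'w measure \<Rightarrow> ('w \<Rightarrow> 'x) \<Rightarrow> ('x \<Rightarrow> (nat \<Rightarrow> real) \<Rightarrow> real) \<Rightarrow> ('x \<Rightarrow> real) \<Rightarrow>
    (nat \<Rightarrow> real) \<Rightarrow> real" where
  "KL P X p q w = (\<integral>\<omega>. llr p q (X \<omega>) w \<partial>P)"

text \<open>
  \<open>X\<close> is a random variable on the probability space \<open>P\<close> with values in \<open>M\<close> and true density \<open>q\<close>.

  The assumption \<open>common_support\<close> makes the log-likelihood ratio a genuine real number (recall
  \<open>ln 0 = 0\<close> and \<open>x / 0 = 0\<close>); it holds in particular if all densities are positive.  Together with
  the normalisation of the densities it gives \<open>E[p(X|w) / q(X)] = 1\<close>.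

  Expectation and parameter derivatives are interchangeable both for the log-likelihood ratio and
  for the likelihood ratio \<open>p(X|w) / q(X)\<close>; the latter amounts to differentiating
  \<open>\<integral> p(x|w) dx = 1\<close> under the integral sign.
\<close>

locale statistical_model = prob_space P
  for P :: "'w measure" +
  fixes M :: "'x measure" and X :: "'w \<Rightarrow> 'x"
    and p :: "'x \<Rightarrow> (nat \<Rightarrow> real) \<Rightarrow> real" and q :: "'x \<Rightarrow> real"
    and d :: nat and \<Theta> :: "(nat \<Rightarrow> real) set"
  assumes parameters: "nbhd0 d \<Theta>"
    and p_measurable: "\<And>w. w \<in> \<Theta> \<Longrightarrow> (\<lambda>x. p x w) \<in> borel_measurable M"
    and p_nonneg: "\<And>x w. x \<in> space M \<Longrightarrow> w \<in> \<Theta> \<Longrightarrow> 0 \<le> p x w"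
    and p_normalised: "\<And>w. w \<in> \<Theta> \<Longrightarrow> (\<integral>\<^sup>+x. ennreal (p x w) \<partial>M) = 1"
    and q_measurable: "q \<in> borel_measurable M"
    and q_nonneg: "\<And>x. x \<in> space M \<Longrightarrow> 0 \<le> q x"
    and X_density: "distributed P M X (\<lambda>x. ennreal (q x))"
    and common_support: "AE x in M. \<forall>w\<in>\<Theta>. 0 < p x w \<longleftrightarrow> 0 < q x"
    and realizable: "AE \<omega> in P. q (X \<omega>) = p (X \<omega>) (\<lambda>_. 0)"
    and KL_analytic: "real_analytic_at_0 d (KL P X p q)"
    and llr_square_integrable:
      "\<exists>\<rho>>0. \<forall>w\<in>cube d \<rho>. square_integrable P (\<lambda>\<omega>. llr p q (X \<omega>) w)"
    and llr_analytic: "L2_analytic_at_0 P d (\<lambda>\<omega>. llr p q (X \<omega>))"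
    and llr_interchange: "interchangeable P d (\<lambda>\<omega>. llr p q (X \<omega>))"
    and lr_interchange: "interchangeable P d (\<lambda>\<omega> w. p (X \<omega>) w / q (X \<omega>))"

text \<open>
  For every \<open>\<tau> \<in> U\<close>, the homogeneous parts of degree \<open>1, \<dots>, m - 1\<close> of the random function \<open>f\<close> in
  the coordinates \<open>\<theta>\<^sub>r\<^sub>+\<^sub>1, \<dots>, \<theta>\<^sub>d\<^sub>1\<close> vanish almost surely.
\<close>

definition vanishes_below ::
  "'w measure \<Rightarrow> nat \<Rightarrow> nat \<Rightarrow> (nat \<Rightarrow> real) set \<Rightarrow> ('w \<Rightarrow> (nat \<Rightarrow> real) \<Rightarrow> real) \<Rightarrow> nat \<Rightarrow> bool" where
  "vanishes_below P r d1 U f m \<longleftrightarrow>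
     (\<forall>\<tau>\<in>U. \<forall>k. 1 \<le> k \<and> k < m \<longrightarrow>
        (AE \<omega> in P. \<forall>\<theta>\<in>vecs d1. taylor_part {r..<d1} k (f \<omega>) (joint d1 (\<lambda>_. 0) \<tau>) \<theta> = 0))"

text \<open>The monomials (exponent vectors in \<open>\<theta>\<close>) that do not occur among the higher order terms.\<close>

definition excluded :: "nat \<Rightarrow> nat \<Rightarrow> nat \<Rightarrow> (nat \<Rightarrow> nat) \<Rightarrow> bool" where
  "excluded r d1 m \<alpha> \<longleftrightarrow>
     (sum \<alpha> {..<r} = 0 \<and> sum \<alpha> {r..<d1} \<le> 2 * m) \<or>
     (sum \<alpha> {..<r} = 1 \<and> sum \<alpha> {r..<d1} \<le> m) \<or>
     (sum \<alpha> {..<r} = 2 \<and> sum \<alpha> {r..<d1} = 0)"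

end

theory Submission
  imports Defs
begin

text \<open>
  Give \<open>\<theta>\<^sub>1, \<dots>, \<theta>\<^sub>r\<close> weight \<open>m\<close> and the other \<open>\<theta>\<^sub>i\<close> weight \<open>1\<close>.  For fixed small \<open>\<tau>\<close> the hypotheses say
  that the expansion of \<open>f\<close> in \<open>\<theta>\<close> starts in weight \<open>m\<close>, with lowest part \<open>F\<^sub>1 + F\<^sub>m\<close>, and the excluded
  monomials all have weight at most \<open>2 m\<close>.  Hence in these weights \<open>e\<^sup>-\<^sup>f\<close> agrees with \<open>1 - f + f\<^sup>2 / 2\<close>,
  and \<open>f\<^sup>2\<close> with \<open>(F\<^sub>1 + F\<^sub>m)\<^sup>2\<close>.  Differentiating \<open>E[e\<^sup>-\<^sup>f] = E[p / q] = 1\<close> under the integral sign shows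
  that the expected coefficients of \<open>e\<^sup>-\<^sup>f\<close> vanish in positive weight, so the coefficients of \<open>K = E[f]\<close>
  are those of \<open>E[(F\<^sub>1 + F\<^sub>m)\<^sup>2] / 2\<close>.
\<close>

subsection \<open>Power series in several variables\<close>

text \<open>Radius and coefficients are explicit parameters because every operation below keeps the
  radius and acts on the coefficients alone. Unconditional summation of reals is absolute, so terms
  may be regrouped freely.\<close>

definition power_series_on ::
  "nat \<Rightarrow> real \<Rightarrow> ((nat \<Rightarrow> nat) \<Rightarrow> real) \<Rightarrow> ((nat \<Rightarrow> real) \<Rightarrow> real) \<Rightarrow> bool" where
  "power_series_on d \<rho> a g \<longleftrightarrow>
     (\<forall>w\<in>cube d \<rho>. ((\<lambda>\<alpha>. a \<alpha> * monomial {..<d} \<alpha> w) has_sum g w) (multi_indices {..<d}))"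

lemma power_series_onD:
  "power_series_on d \<rho> a g \<Longrightarrow> w \<in> cube d \<rho> \<Longrightarrow>
    ((\<lambda>\<alpha>. a \<alpha> * monomial {..<d} \<alpha> w) has_sum g w) (multi_indices {..<d})"
  by (simp add: power_series_on_def)

lemma cube_mono: "\<epsilon> \<le> \<rho> \<Longrightarrow> w \<in> cube d \<epsilon> \<Longrightarrow> w \<in> cube d \<rho>"
  unfolding cube_def by force

lemma power_series_on_mono: "power_series_on d \<rho> a g \<Longrightarrow> \<epsilon> \<le> \<rho> \<Longrightarrow> power_series_on d \<epsilon> a g"
  using cube_mono unfolding power_series_on_def by blast

lemma cube_fun_upd: "v \<in> cube d \<rho> \<Longrightarrow> i < d \<Longrightarrow> \<bar>t\<bar> < \<rho> \<Longrightarrow> v(i := t) \<in> cube d \<rho>"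
  unfolding cube_def vecs_def by auto

lemma zero_in_cube: "0 < \<rho> \<Longrightarrow> (\<lambda>_. 0) \<in> cube d \<rho>"
  unfolding cube_def vecs_def by auto

lemma abs_in_cube: "v \<in> cube d \<rho> \<Longrightarrow> (\<lambda>i. \<bar>v i\<bar>) \<in> cube d \<rho>"
  unfolding cube_def vecs_def by auto

lemma abs_monomial: "\<bar>monomial J \<alpha> w\<bar> = monomial J \<alpha> (\<lambda>i. \<bar>w i\<bar>)"
  unfolding monomial_def by (simp add: abs_prod power_abs)

lemma monomial_fun_upd:
  assumes "finite J" "i \<in> J"
  shows "monomial J \<alpha> (v(i := t)) = t ^ \<alpha> i * monomial (J - {i}) \<alpha> v"
proof -
  have "monomial J \<alpha> (v(i := t)) = t ^ \<alpha> i * (\<Prod>j\<in>J - {i}. (v(i := t)) j ^ \<alpha> j)"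
    unfolding monomial_def by (subst prod.remove[OF assms]) simp
  also have "(\<Prod>j\<in>J - {i}. (v(i := t)) j ^ \<alpha> j) = monomial (J - {i}) \<alpha> v"
    unfolding monomial_def by (rule prod.cong) auto
  finally show ?thesis .
qed

text \<open>Since convergence is absolute, taking absolute values of the coefficients keeps the cube
  of convergence. The result supplies the majorants for the rearrangements in termwise
  differentiation and in the exponential.\<close>

lemma power_series_on_abs:
  assumes "power_series_on d \<rho> b g"
  shows "power_series_on d \<rho> (\<lambda>\<alpha>. \<bar>b \<alpha>\<bar>)
    (\<lambda>w. \<Sum>\<^sub>\<infinity>\<alpha>\<in>multi_indices {..<d}. \<bar>b \<alpha>\<bar> * monomial {..<d} \<alpha> w)"
  unfolding power_series_on_def
proof
  fix w assume "w \<in> cube d \<rho>"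
  then have "(\<lambda>\<alpha>. b \<alpha> * monomial {..<d} \<alpha> w) summable_on multi_indices {..<d}"
    using power_series_onD[OF assms] by (blast intro: has_sum_imp_summable)
  then have "(\<lambda>\<alpha>. norm (b \<alpha> * monomial {..<d} \<alpha> w)) summable_on multi_indices {..<d}"
    by (subst (asm) summable_on_iff_abs_summable_on_real)
  then have "(\<lambda>\<alpha>. \<bar>b \<alpha>\<bar> * monomial {..<d} \<alpha> w) summable_on multi_indices {..<d}"
    by (subst summable_on_iff_abs_summable_on_real) (simp add: abs_mult)
  then show "((\<lambda>\<alpha>. \<bar>b \<alpha>\<bar> * monomial {..<d} \<alpha> w) has_sum
      (\<Sum>\<^sub>\<infinity>\<alpha>\<in>multi_indices {..<d}. \<bar>b \<alpha>\<bar> * monomial {..<d} \<alpha> w)) (multi_indices {..<d})"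
    by (rule has_sum_infsum)
qed

section \<open>One-variable slices and termwise differentiation\<close>

definition slice_coeff ::
  "nat \<Rightarrow> nat \<Rightarrow> ((nat \<Rightarrow> nat) \<Rightarrow> real) \<Rightarrow> (nat \<Rightarrow> real) \<Rightarrow> nat \<Rightarrow> real" where
  "slice_coeff d i b v n =
     (\<Sum>\<^sub>\<infinity>\<alpha>\<in>{\<alpha>\<in>multi_indices {..<d}. \<alpha> i = n}. b \<alpha> * monomial ({..<d} - {i}) \<alpha> v)"

text \<open>Grouping the multi-indices by their exponent at \<open>i\<close> turns the series into a
  power series in the single variable \<open>t\<close>, to which the one-variable theory
  applies.\<close>

lemma power_series_on_slice:
  assumes ps: "power_series_on d \<rho> b g" and v: "v \<in> cube d \<rho>" and i: "i < d" 
  shows has_sum_slice_coeff: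
    "((\<lambda>\<alpha>. b \<alpha> * monomial ({..<d} - {i}) \<alpha> v) has_sum slice_coeff d i b v n)
       {\<alpha>\<in>multi_indices {..<d}. \<alpha> i = n}" (is ?t1)
    and has_sum_slice:
    "\<bar>t\<bar> < \<rho> \<Longrightarrow> ((\<lambda>n. slice_coeff d i b v n * t ^ n) has_sum g (v(i := t))) UNIV"
proof -
  let ?F = "\<lambda>n. {\<alpha>\<in>multi_indices {..<d}. \<alpha> i = n}"
  let ?M = "\<lambda>\<alpha>. b \<alpha> * monomial ({..<d} - {i}) \<alpha> v"
  have mon: "monomial {..<d} \<alpha> (v(i := t)) = t ^ \<alpha> i * monomial ({..<d} - {i}) \<alpha> v" for \<alpha> t
    using i by (intro monomial_fun_upd) auto
  have hs: "((\<lambda>\<alpha>. ?M \<alpha> * t ^ \<alpha> i) has_sum g (v(i := t))) (multi_indices {..<d})"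
    if "\<bar>t\<bar> < \<rho>" for t
    using power_series_onD[OF ps cube_fun_upd[OF v i that]] unfolding mon by (simp add: mult_ac)
  have sm: "?M summable_on ?F n" for n
  proof -
    \<comment> \<open>Any nonzero point inside the radius serves: there the factor
      \<open>t ^ n\<close>, constant on the slice, can be divided out.\<close>
    define t where "t = \<rho> / 2"
    have "\<bar>v i\<bar> < \<rho>" using v i by (auto simp: cube_def)
    then have t: "\<bar>t\<bar> < \<rho>" "t \<noteq> 0" by (auto simp: t_def)
    have "(\<lambda>\<alpha>. ?M \<alpha> * t ^ \<alpha> i) summable_on ?F n"
      by (rule summable_on_subset[OF has_sum_imp_summable[OF hs[OF t(1)]]]) auto
    then have "(\<lambda>\<alpha>. ?M \<alpha> * t ^ n) summable_on ?F n"
      by (subst (asm) summable_on_cong[where g = "\<lambda>\<alpha>. ?M \<alpha> * t ^ n"]) auto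
    then show ?thesis using t(2) by (simp add: summable_on_cmult_left')
  qed
  show t1: "(?M has_sum slice_coeff d i b v n) (?F n)" for n
    unfolding slice_coeff_def using sm by (rule has_sum_infsum)
  assume t: "\<bar>t\<bar> < \<rho>"
  have "((\<lambda>(n, \<alpha>). ?M \<alpha> * t ^ n) has_sum g (v(i := t))) (Sigma UNIV ?F)"
    by (subst has_sum_reindex_bij_witness[where j = snd and i = "\<lambda>\<alpha>. (\<alpha> i, \<alpha>)"
          and T = "multi_indices {..<d}" and h = "\<lambda>\<alpha>. ?M \<alpha> * t ^ \<alpha> i"])
      (use hs[OF t] in auto)
  then show "((\<lambda>n. slice_coeff d i b v n * t ^ n) has_sum g (v(i := t))) UNIV"
    by (rule has_sum_SigmaD) (use t1 in \<open>auto intro!: has_sum_cmult_left\<close>)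
qed

text \<open>Coefficients of the termwise derivative in coordinate \<open>i\<close>: the term with
  exponent \<open>Suc (\<alpha> i)\<close> drops to exponent \<open>\<alpha> i\<close> and brings
  down its exponent as a factor.\<close>

definition shift_coeff :: "nat \<Rightarrow> ((nat \<Rightarrow> nat) \<Rightarrow> real) \<Rightarrow> (nat \<Rightarrow> nat) \<Rightarrow> real" where
  "shift_coeff i b \<alpha> = real (Suc (\<alpha> i)) * b (\<alpha>(i := Suc (\<alpha> i)))"

text \<open>The one-variable theorem differentiates the slice series. Reassembling the result over
  multi-indices needs an absolutely summable double family; this follows from the same slice
  argument for \<open>\<bar>b\<bar>\<close> at the point of absolute values of
  \<open>v\<close>.\<close>

lemma power_series_on_partial:
  assumes ps: "power_series_on d \<rho> b g" and i: "i < d"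
  shows "power_series_on d \<rho> (shift_coeff i b) (partial i g)"
  unfolding power_series_on_def
proof
  fix v assume v: "v \<in> cube d \<rho>"
  define t where "t = v i"
  have t: "\<bar>t\<bar> < \<rho>" using v i by (auto simp: cube_def t_def)
  let ?F = "\<lambda>n. {\<alpha>\<in>multi_indices {..<d}. \<alpha> i = n}"
  let ?M = "\<lambda>\<alpha>. monomial ({..<d} - {i}) \<alpha> v"
  let ?M' = "\<lambda>\<alpha>. monomial ({..<d} - {i}) \<alpha> (\<lambda>i. \<bar>v i\<bar>)"
  define c where "c = slice_coeff d i b v"
  define c' where "c' = slice_coeff d i (\<lambda>\<alpha>. \<bar>b \<alpha>\<bar>) (\<lambda>i. \<bar>v i\<bar>)"
  note ps' = power_series_on_abs[OF ps]
  have sums: "(\<lambda>n. c n * z ^ n) sums g (v(i := z))" if "norm z < \<rho>" for z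
    unfolding c_def using has_sum_slice[OF ps v i, of z] that by (intro has_sum_imp_sums) auto
  have sums': "summable (\<lambda>n. c' n * z ^ n)" if "norm z < \<rho>" for z
    unfolding c'_def using has_sum_slice[OF ps' abs_in_cube[OF v] i, of z] that
    by (intro sums_summable[OF has_sum_imp_sums]) auto
  define D where "D = (\<Sum>n. diffs c n * t ^ n)"
  have "((\<lambda>z. \<Sum>n. c n * z ^ n) has_field_derivative D) (at t)"
    unfolding D_def using sums t by (intro termdiffs_strong'[where K = \<rho>]) (auto intro: sums_summable)
  then have "((\<lambda>z. g (v(i := z))) has_field_derivative D) (at t)"
    by (rule has_field_derivative_transform_within_open[where S = "ball 0 \<rho>"])
      (use sums t in \<open>auto simp: sums_iff\<close>)
  then have D: "partial i g v = D"
    unfolding partial_def t_def[symmetric] by (rule DERIV_imp_deriv)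
  have outer: "(\<lambda>n. real n * c n * t ^ (n - 1)) sums D"
    unfolding D_def using diffs_equiv[OF termdiff_converges[OF _ sums_summable[OF sums]], of t \<rho>] t by simp
  have outer': "summable (\<lambda>n. real n * c' n * \<bar>t\<bar> ^ (n - 1))"
    using diffs_equiv[OF termdiff_converges[OF _ sums'], of "\<bar>t\<bar>" \<rho>] t by (simp add: sums_iff)
  let ?h = "\<lambda>(n, \<alpha>). real n * (b \<alpha> * ?M \<alpha>) * t ^ (n - 1)"
  have inner': "((\<lambda>\<alpha>. \<bar>?h (n, \<alpha>)\<bar>) has_sum real n * c' n * \<bar>t\<bar> ^ (n - 1)) (?F n)" for n
    using has_sum_slice_coeff[OF ps' abs_in_cube[OF v] i, of n, folded c'_def]
    by (auto simp: abs_mult power_abs abs_monomial intro!: has_sum_cmult_left has_sum_cmult_right)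
  have c'_nonneg: "0 \<le> real n * c' n * \<bar>t\<bar> ^ (n - 1)" for n
    by (rule has_sum_nonneg[OF inner']) auto
  have "(\<lambda>x. \<bar>?h x\<bar>) summable_on (Sigma UNIV ?F)"
    by (rule summable_on_SigmaI[OF inner' summable_nonneg_imp_summable_on[OF outer' c'_nonneg] abs_ge_zero])
  then have "?h summable_on (Sigma UNIV ?F)"
    by (subst summable_on_iff_abs_summable_on_real) simp
  then obtain S where S: "(?h has_sum S) (Sigma UNIV ?F)"
    by (auto simp: summable_on_def)
  \<comment> \<open>Summing the double family slice by slice gives the one-variable derivative,
    which identifies its total as \<open>D\<close>.\<close>
  have "((\<lambda>n. real n * c n * t ^ (n - 1)) has_sum S) UNIV"
    by (rule has_sum_SigmaD[OF S])
      (use has_sum_slice_coeff[OF ps v i, folded c_def] in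
        \<open>auto intro!: has_sum_cmult_left has_sum_cmult_right\<close>)
  then have "S = D"
    using outer has_sum_imp_sums sums_unique2 by blast
  with S have "(?h has_sum D) (Sigma UNIV ?F)" by simp
  also have "?this \<longleftrightarrow> ((\<lambda>\<alpha>. ?h (\<alpha> i, \<alpha>)) has_sum D) (multi_indices {..<d})"
    by (rule has_sum_reindex_bij_witness[where j = snd and i = "\<lambda>\<alpha>. (\<alpha> i, \<alpha>)"]) auto
  \<comment> \<open>Terms with exponent 0 at \<open>i\<close> vanish through the factor
    \<open>real n\<close>, whatever the truncated \<open>n - 1\<close> is. On the remaining indices,
    lowering the exponent at \<open>i\<close> is a bijection onto all multi-indices.\<close>
  also have "\<dots> \<longleftrightarrow> ((\<lambda>\<alpha>. ?h (\<alpha> i, \<alpha>)) has_sum D) {\<alpha>\<in>multi_indices {..<d}. \<alpha> i \<noteq> 0}"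
    by (rule has_sum_cong_neutral) auto
  also have "\<dots> \<longleftrightarrow> ((\<lambda>\<alpha>. shift_coeff i b \<alpha> * monomial {..<d} \<alpha> v) has_sum D) (multi_indices {..<d})"
  proof (rule has_sum_reindex_bij_witness[where j = "\<lambda>\<alpha>. \<alpha>(i := \<alpha> i - 1)" and i = "\<lambda>\<alpha>. \<alpha>(i := Suc (\<alpha> i))"])
    fix \<alpha> :: "nat \<Rightarrow> nat" assume \<alpha>: "\<alpha> \<in> {\<alpha>\<in>multi_indices {..<d}. \<alpha> i \<noteq> 0}"
    have "monomial {..<d} (\<alpha>(i := \<alpha> i - 1)) (v(i := t)) =
        t ^ (\<alpha> i - 1) * monomial ({..<d} - {i}) (\<alpha>(i := \<alpha> i - 1)) v"
      using i by (subst monomial_fun_upd) auto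
    also have "monomial ({..<d} - {i}) (\<alpha>(i := \<alpha> i - 1)) v = ?M \<alpha>"
      unfolding monomial_def by (rule prod.cong) auto
    also have "v(i := t) = v" by (simp add: t_def)
    finally have "monomial {..<d} (\<alpha>(i := \<alpha> i - 1)) v = t ^ (\<alpha> i - 1) * ?M \<alpha>" .
    then show "shift_coeff i b (\<alpha>(i := \<alpha> i - 1)) * monomial {..<d} (\<alpha>(i := \<alpha> i - 1)) v = ?h (\<alpha> i, \<alpha>)"
      using \<alpha> by (simp add: shift_coeff_def del: of_nat_Suc)
  qed (use i in \<open>auto simp: multi_indices_def\<close>)
  finally show "((\<lambda>\<alpha>. shift_coeff i b \<alpha> * monomial {..<d} \<alpha> v) has_sum partial i g v) (multi_indices {..<d})"
    by (simp add: D)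
qed

section \<open>Coefficients as iterated derivatives at the origin\<close>

lemma shift_coeff_funpow:
  "(shift_coeff i ^^ n) b \<alpha> = pochhammer (real (Suc (\<alpha> i))) n * b (\<alpha>(i := \<alpha> i + n))"
proof (induction n arbitrary: \<alpha>)
  case (Suc n)
  have "(shift_coeff i ^^ Suc n) b \<alpha> =
      real (Suc (\<alpha> i)) * (shift_coeff i ^^ n) b (\<alpha>(i := Suc (\<alpha> i)))"
    unfolding funpow.simps o_apply by (subst shift_coeff_def) rule
  then show ?case
    by (simp add: Suc.IH pochhammer_rec add_ac fun_upd_def if_distrib cong: if_cong)
qed simp

lemma power_series_on_funpow_partial:
  "power_series_on d \<rho> b g \<Longrightarrow> i < d \<Longrightarrow>
    power_series_on d \<rho> ((shift_coeff i ^^ n) b) ((partial i ^^ n) g)"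
  by (induction n) (auto intro: power_series_on_partial)

lemma power_series_on_fold_partial:
  "power_series_on d \<rho> b g \<Longrightarrow> set xs \<subseteq> {..<d} \<Longrightarrow>
    power_series_on d \<rho> (fold (\<lambda>i. shift_coeff i ^^ \<alpha> i) xs b) (fold (\<lambda>i. partial i ^^ \<alpha> i) xs g)"
  by (induction xs arbitrary: b g) (auto intro: power_series_on_funpow_partial)

text \<open>Each coordinate of \<open>xs\<close> is shifted once, starting from exponent 0, so the
  rising factorials from \<open>shift_coeff_funpow\<close> start at 1 and become factorials.\<close>

lemma fold_shift_coeff:
  "distinct xs \<Longrightarrow> (\<And>i. i \<in> set xs \<Longrightarrow> \<beta> i = 0) \<Longrightarrow>
    fold (\<lambda>i. shift_coeff i ^^ \<alpha> i) xs b \<beta> =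
      (\<Prod>i\<in>set xs. fact (\<alpha> i)) * b (\<lambda>i. if i \<in> set xs then \<alpha> i else \<beta> i)"
proof (induction xs arbitrary: b)
  case (Cons x xs)
  have "(\<lambda>i. if i \<in> set xs then \<alpha> i else \<beta> i)(x := \<alpha> x) = (\<lambda>i. if i \<in> set (x # xs) then \<alpha> i else \<beta> i)"
    by auto
  with Cons show ?case
    by (simp add: shift_coeff_funpow pochhammer_fact[symmetric])
qed simp

lemma power_series_on_0:
  assumes "power_series_on d \<rho> b g" "0 < \<rho>"
  shows "g (\<lambda>_. 0) = b (\<lambda>_. 0)"
proof -
  have "((\<lambda>\<alpha>. b \<alpha> * monomial {..<d} \<alpha> (\<lambda>_. 0)) has_sum b (\<lambda>_. 0)) (multi_indices {..<d})"
  proof (rule has_sum_finite_neutralI[where B = "{\<lambda>_. 0}"])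
    fix \<alpha> :: "nat \<Rightarrow> nat" assume "\<alpha> \<in> multi_indices {..<d} - {\<lambda>_. 0}"
    then obtain i where "i < d" "\<alpha> i \<noteq> 0"
      unfolding multi_indices_def by (auto simp: fun_eq_iff) (metis neq0_conv)
    then show "b \<alpha> * monomial {..<d} \<alpha> (\<lambda>_. 0) = 0"
      by (auto simp: monomial_def intro!: prod_zero)
  qed (auto simp: multi_indices_def monomial_def)
  then show ?thesis
    using power_series_onD[OF assms(1) zero_in_cube[OF assms(2)]] has_sum_unique by blast
qed

text \<open>Differentiating termwise along the sorted list and evaluating at the origin leaves a
  single coefficient. The fixed order of differentiation is followed literally, so no symmetry of
  mixed derivatives enters.\<close>

lemma mixed_partial_power_series:
  assumes "power_series_on d \<rho> b g" "0 < \<rho>" "J \<subseteq> {..<d}" "\<alpha> \<in> multi_indices J"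
  shows "mixed_partial J \<alpha> g (\<lambda>_. 0) = (\<Prod>i\<in>J. fact (\<alpha> i)) * b \<alpha>"
proof -
  have J: "finite J" using assms(3) finite_subset by blast
  have "(\<lambda>i. if i \<in> J then \<alpha> i else 0) = \<alpha>"
    using assms(4) by (auto simp: multi_indices_def)
  then show ?thesis
    using power_series_on_0[OF power_series_on_fold_partial[OF assms(1)] assms(2), of "sorted_list_of_set J" \<alpha>]
      fold_shift_coeff[of "sorted_list_of_set J" "\<lambda>_. 0" \<alpha> b] J assms(3)
    by (simp add: mixed_partial_def)
qed

lemma power_series_on_unique:
  assumes "power_series_on d \<rho> b g" "power_series_on d \<rho> c g" "0 < \<rho>" "\<alpha> \<in> multi_indices {..<d}"
  shows "b \<alpha> = c \<alpha>"
proof -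
  have "(\<Prod>i<d. fact (\<alpha> i)) * b \<alpha> = (\<Prod>i<d. fact (\<alpha> i)) * c \<alpha>"
    using mixed_partial_power_series[OF _ assms(3) order.refl assms(4)] assms(1,2) by metis
  then show ?thesis by simp
qed

subsection \<open>Products and exponentials\<close>

lemma zero_in_multi_indices [simp]: "(\<lambda>_. 0) \<in> multi_indices J"
  by (simp add: multi_indices_def)

lemma multi_indices_le: "\<alpha> \<in> multi_indices J \<Longrightarrow> \<beta> \<le> \<alpha> \<Longrightarrow> \<beta> \<in> multi_indices J"
  unfolding multi_indices_def le_fun_def by simp (metis le_zero_eq)

lemma finite_multi_indices_le:
  assumes "finite J" "\<alpha> \<in> multi_indices J"
  shows "finite {..\<alpha>}"
proof (rule finite_subset)
  have "\<beta> i \<le> sum \<alpha> J" if "\<beta> \<le> \<alpha>" "i \<in> J" for \<beta> i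
    using that assms(1) member_le_sum[of i J \<alpha>] le_funD[of \<beta> \<alpha> i] by simp
  then show "{..\<alpha>} \<subseteq> {\<beta>. \<forall>i. (i \<in> J \<longrightarrow> \<beta> i \<in> {..sum \<alpha> J}) \<and> (i \<notin> J \<longrightarrow> \<beta> i = 0)}"
    using multi_indices_le[OF assms(2)] by (auto simp: multi_indices_def)
  show "finite {\<beta>. \<forall>i. (i \<in> J \<longrightarrow> \<beta> i \<in> {..sum \<alpha> J}) \<and> (i \<notin> J \<longrightarrow> \<beta> i = (0::nat))}"
    by (intro finite_set_of_finite_funs assms) simp
qed

lemma finite_multi_indices_sum:
  assumes "finite J"
  shows "finite {\<alpha> \<in> multi_indices J. sum \<alpha> J = k}"
proof (rule finite_subset)
  show "{\<alpha> \<in> multi_indices J. sum \<alpha> J = k} \<subseteq> {\<beta>. \<forall>i. (i \<in> J \<longrightarrow> \<beta> i \<in> {..k}) \<and> (i \<notin> J \<longrightarrow> \<beta> i = 0)}"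
    using assms by (auto simp: multi_indices_def intro: member_le_sum)
  show "finite {\<beta>. \<forall>i. (i \<in> J \<longrightarrow> \<beta> i \<in> {..k}) \<and> (i \<notin> J \<longrightarrow> \<beta> i = (0::nat))}"
    by (intro finite_set_of_finite_funs assms) simp
qed

lemma monomial_add: "monomial J (\<lambda>i. \<beta> i + \<gamma> i) w = monomial J \<beta> w * monomial J \<gamma> w"
  unfolding monomial_def by (simp add: power_add prod.distrib)

text \<open>Coefficients of the Cauchy product. The subtraction is exact because
  \<open>\<beta> \<le> \<alpha>\<close> holds pointwise; the range of summation is finite when
  \<open>\<alpha>\<close> is a multi-index over a finite set.\<close>

definition conv ::
  "((nat \<Rightarrow> nat) \<Rightarrow> real) \<Rightarrow> ((nat \<Rightarrow> nat) \<Rightarrow> real) \<Rightarrow> (nat \<Rightarrow> nat) \<Rightarrow> real" where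
  "conv b c \<alpha> = (\<Sum>\<beta>\<le>\<alpha>. b \<beta> * c (\<lambda>i. \<alpha> i - \<beta> i))"

text \<open>The double family of products is absolutely summable, and the map from
  \<open>(\<beta>, \<gamma>)\<close> to their sum paired with \<open>\<beta>\<close> regroups it
  into the finite fibres over which \<open>conv\<close> sums.\<close>

lemma power_series_on_mult:
  assumes b: "power_series_on d \<rho> b g" and c: "power_series_on d \<rho> c h"
  shows "power_series_on d \<rho> (conv b c) (\<lambda>w. g w * h w)"
  unfolding power_series_on_def
proof
  fix w assume w: "w \<in> cube d \<rho>"
  let ?I = "multi_indices {..<d}"
  let ?m = "\<lambda>\<alpha>. monomial {..<d} \<alpha> w"
  note hb = power_series_onD[OF b w] and hc = power_series_onD[OF c w]
  have abs: "(\<lambda>\<alpha>. \<bar>b \<alpha> * ?m \<alpha>\<bar>) summable_on ?I" "(\<lambda>\<alpha>. \<bar>c \<alpha> * ?m \<alpha>\<bar>) summable_on ?I"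
    using hb hc by (auto simp flip: real_norm_def summable_on_iff_abs_summable_on_real intro: has_sum_imp_summable)
  have "(\<lambda>(\<beta>, \<gamma>). \<bar>b \<beta> * ?m \<beta>\<bar> * \<bar>c \<gamma> * ?m \<gamma>\<bar>) summable_on ?I \<times> ?I"
    by (rule summable_on_SigmaI[where g = "\<lambda>\<beta>. \<bar>b \<beta> * ?m \<beta>\<bar> * (\<Sum>\<^sub>\<infinity>\<gamma>\<in>?I. \<bar>c \<gamma> * ?m \<gamma>\<bar>)"])
      (use abs in \<open>auto intro!: has_sum_cmult_right summable_on_cmult_left has_sum_infsum\<close>)
  then have sm: "(\<lambda>(\<beta>, \<gamma>). (b \<beta> * ?m \<beta>) * (c \<gamma> * ?m \<gamma>)) summable_on ?I \<times> ?I"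
    by (subst summable_on_iff_abs_summable_on_real) (simp add: abs_mult case_prod_unfold)
  have "((\<lambda>(\<beta>, \<gamma>). (b \<beta> * ?m \<beta>) * (c \<gamma> * ?m \<gamma>)) has_sum g w * h w) (?I \<times> ?I)"
    by (rule has_sum_SigmaI[where g = "\<lambda>\<beta>. (b \<beta> * ?m \<beta>) * h w"])
      (use hb hc sm in \<open>auto intro: has_sum_cmult_left has_sum_cmult_right\<close>)
  also have "?this \<longleftrightarrow> ((\<lambda>(\<alpha>, \<beta>). b \<beta> * c (\<lambda>i. \<alpha> i - \<beta> i) * ?m \<alpha>) has_sum g w * h w) (SIGMA \<alpha>:?I. {..\<alpha>})"
  proof (rule has_sum_reindex_bij_witness[where j = "\<lambda>(\<beta>, \<gamma>). (\<lambda>i. \<beta> i + \<gamma> i, \<beta>)"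
        and i = "\<lambda>(\<alpha>, \<beta>). (\<beta>, \<lambda>i. \<alpha> i - \<beta> i)"])
    fix x assume "x \<in> ?I \<times> ?I"
    then show "(case case x of (\<beta>, \<gamma>) \<Rightarrow> (\<lambda>i. \<beta> i + \<gamma> i, \<beta>) of (\<alpha>, \<beta>) \<Rightarrow> b \<beta> * c (\<lambda>i. \<alpha> i - \<beta> i) * ?m \<alpha>) =
        (case x of (\<beta>, \<gamma>) \<Rightarrow> (b \<beta> * ?m \<beta>) * (c \<gamma> * ?m \<gamma>))"
      by (auto simp: monomial_add)
  next
    fix x assume x: "x \<in> (SIGMA \<alpha>:?I. {..\<alpha>})"
    then show "(case x of (\<alpha>, \<beta>) \<Rightarrow> (\<beta>, \<lambda>i. \<alpha> i - \<beta> i)) \<in> ?I \<times> ?I"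
      by (auto intro: multi_indices_le simp: le_fun_def)
    show "(case case x of (\<alpha>, \<beta>) \<Rightarrow> (\<beta>, \<lambda>i. \<alpha> i - \<beta> i) of (\<beta>, \<gamma>) \<Rightarrow> (\<lambda>i. \<beta> i + \<gamma> i, \<beta>)) = x"
      using x by (auto simp: le_fun_def)
  qed (auto simp: multi_indices_def le_fun_def)
  finally show "((\<lambda>\<alpha>. conv b c \<alpha> * ?m \<alpha>) has_sum g w * h w) ?I"
  proof (rule has_sum_SigmaD)
    fix \<alpha> assume "\<alpha> \<in> ?I"
    then have "finite {..\<alpha>}" by (rule finite_multi_indices_le[rotated]) simp
    then show "((\<lambda>\<beta>. case (\<alpha>, \<beta>) of (\<alpha>, \<beta>) \<Rightarrow> b \<beta> * c (\<lambda>i. \<alpha> i - \<beta> i) * ?m \<alpha>) has_sum conv b c \<alpha> * ?m \<alpha>) {..\<alpha>}"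
      by (auto simp: conv_def sum_distrib_right intro!: has_sum_finiteI)
  qed
qed

text \<open>The unit of the Cauchy product: iterating \<open>conv b\<close> from it \<open>k\<close>
  times gives the coefficients of the \<open>k\<close>-th power.\<close>

definition conv_one :: "(nat \<Rightarrow> nat) \<Rightarrow> real" where
  "conv_one \<alpha> = (if \<alpha> = (\<lambda>_. 0) then 1 else 0)"

lemma power_series_on_one: "power_series_on d \<rho> conv_one (\<lambda>_. 1)"
  unfolding power_series_on_def
  by (intro ballI has_sum_finite_neutralI[where B = "{\<lambda>_. 0}"]) (auto simp: conv_one_def monomial_def)

lemma power_series_on_power:
  "power_series_on d \<rho> b g \<Longrightarrow> power_series_on d \<rho> ((conv b ^^ k) conv_one) (\<lambda>w. g w ^ k)"
  by (induction k) (auto intro: power_series_on_one power_series_on_mult)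

lemma abs_conv_power_le: "\<bar>(conv b ^^ k) conv_one \<alpha>\<bar> \<le> (conv (\<lambda>\<beta>. \<bar>b \<beta>\<bar>) ^^ k) conv_one \<alpha>"
proof (induction k arbitrary: \<alpha>)
  case (Suc k)
  have "\<bar>conv b c \<alpha>\<bar> \<le> conv (\<lambda>\<beta>. \<bar>b \<beta>\<bar>) c' \<alpha>" if "\<And>\<beta>. \<bar>c \<beta>\<bar> \<le> c' \<beta>" for c c' \<alpha>
    unfolding conv_def
    by (rule order.trans[OF sum_abs]) (auto simp: abs_mult intro!: sum_mono mult_left_mono that)
  from this[OF Suc] show ?case by simp
qed (simp add: conv_one_def)

text \<open>An infinite sum over \<open>k\<close>, because with a nonzero constant term all powers
  can contribute to the same coefficient.\<close>

definition exp_coeff :: "((nat \<Rightarrow> nat) \<Rightarrow> real) \<Rightarrow> (nat \<Rightarrow> nat) \<Rightarrow> real" where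
  "exp_coeff b \<alpha> = (\<Sum>\<^sub>\<infinity>k. (conv b ^^ k) conv_one \<alpha> / fact k)"

text \<open>The exponential series in \<open>k\<close> and the power series of each
  \<open>k\<close>-th power form one double family. It is dominated by the family for
  \<open>\<bar>b\<bar>\<close>, whose total is \<open>exp A\<close>, so the two summations can be
  exchanged.\<close>

lemma power_series_on_exp:
  assumes ps: "power_series_on d \<rho> b g"
  shows "power_series_on d \<rho> (exp_coeff b) (\<lambda>w. exp (g w))"
  unfolding power_series_on_def
proof
  fix w assume w: "w \<in> cube d \<rho>"
  let ?I = "multi_indices {..<d}"
  let ?m = "\<lambda>\<alpha>. monomial {..<d} \<alpha> w"
  let ?b = "\<lambda>\<beta>. \<bar>b \<beta>\<bar>"
  let ?p = "\<lambda>b (k::nat). (conv b ^^ k) conv_one"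
  define A where "A = (\<Sum>\<^sub>\<infinity>\<alpha>\<in>?I. \<bar>b \<alpha>\<bar> * monomial {..<d} \<alpha> (\<lambda>i. \<bar>w i\<bar>))"
  have A: "((\<lambda>\<alpha>. ?p ?b k \<alpha> * \<bar>?m \<alpha>\<bar>) has_sum A ^ k) ?I" for k
    using power_series_onD[OF power_series_on_power[OF power_series_on_abs[OF ps]] abs_in_cube[OF w]]
    unfolding A_def abs_monomial .
  have p_nonneg: "0 \<le> ?p ?b k \<alpha>" for k \<alpha>
    using abs_conv_power_le[of k b \<alpha>] by linarith
  have A0: "0 \<le> A"
    using has_sum_nonneg[OF A[of 1]] p_nonneg[of 1] by simp
  have exp_sums: "((\<lambda>k. x ^ k / fact k) has_sum exp x) UNIV" for x :: real
    using norm_summable_imp_has_sum[OF summable_norm_exp, of x] exp_converges[of x]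
    by (simp add: divide_inverse mult.commute)
  have "(\<lambda>(k, \<alpha>). ?p ?b k \<alpha> * \<bar>?m \<alpha>\<bar> / fact k) summable_on (UNIV \<times> ?I)"
    by (rule summable_on_SigmaI[where g = "\<lambda>k. A ^ k / fact k"])
      (use A exp_sums[of A] p_nonneg in \<open>auto simp: divide_inverse intro: has_sum_cmult_left has_sum_imp_summable\<close>)
  then have "(\<lambda>x. norm (case x of (k, \<alpha>) \<Rightarrow> ?p b k \<alpha> * ?m \<alpha> / fact k)) summable_on (UNIV \<times> ?I)"
    by (rule summable_on_comparison_test)
      (auto simp: abs_mult intro!: divide_right_mono mult_right_mono abs_conv_power_le)
  then have sm: "(\<lambda>(k, \<alpha>). ?p b k \<alpha> * ?m \<alpha> / fact k) summable_on (UNIV \<times> ?I)"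
    by (rule abs_summable_summable)
  have "((\<lambda>(k, \<alpha>). ?p b k \<alpha> * ?m \<alpha> / fact k) has_sum exp (g w)) (UNIV \<times> ?I)"
    by (rule has_sum_SigmaI[where g = "\<lambda>k. g w ^ k / fact k"])
      (use power_series_onD[OF power_series_on_power[OF ps] w] exp_sums sm in
        \<open>auto simp: divide_inverse intro: has_sum_cmult_left\<close>)
  then have pairs: "((\<lambda>(\<alpha>, k). ?p b k \<alpha> * ?m \<alpha> / fact k) has_sum exp (g w)) (?I \<times> UNIV)"
    by (subst (asm) has_sum_swap) simp
  show "((\<lambda>\<alpha>. exp_coeff b \<alpha> * ?m \<alpha>) has_sum exp (g w)) ?I"
  proof (rule has_sum_SigmaD[OF pairs])
    fix \<alpha> assume \<alpha>: "\<alpha> \<in> ?I"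
    show "((\<lambda>k. case (\<alpha>, k) of (\<alpha>, k) \<Rightarrow> ?p b k \<alpha> * ?m \<alpha> / fact k) has_sum exp_coeff b \<alpha> * ?m \<alpha>) UNIV"
    \<comment> \<open>Where the monomial vanishes at \<open>w\<close>, all terms and the claimed sum
      are 0. Elsewhere it can be divided out, which gives summability in \<open>k\<close> and thus
      makes the infinite sum in \<open>exp_coeff\<close> meaningful.\<close>
    proof (cases "?m \<alpha> = 0")
      case False
      have "(\<lambda>k. ?p b k \<alpha> / fact k * ?m \<alpha>) summable_on UNIV"
        using summable_on_SigmaD1[where f = "\<lambda>\<alpha> k. ?p b k \<alpha> * ?m \<alpha> / fact k",
            OF has_sum_imp_summable[OF pairs] \<alpha>] by simp
      then have "(\<lambda>k. ?p b k \<alpha> / fact k) summable_on UNIV"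
        using False by (simp only: summable_on_cmult_left' simp_thms)
      then have "((\<lambda>k. ?p b k \<alpha> / fact k) has_sum exp_coeff b \<alpha>) UNIV"
        unfolding exp_coeff_def by (rule has_sum_infsum)
      from has_sum_cmult_left[OF this, of "?m \<alpha>"] show ?thesis by simp
    qed simp
  qed
qed

subsection \<open>Restriction to the first block of coordinates\<close>

definition append_index :: "nat \<Rightarrow> (nat \<Rightarrow> nat) \<Rightarrow> (nat \<Rightarrow> nat) \<Rightarrow> nat \<Rightarrow> nat" where
  "append_index d1 \<beta> \<gamma> = (\<lambda>i. if i < d1 then \<beta> i else \<gamma> (i - d1))"

text \<open>The coefficient at exponent \<open>\<beta>\<close> of the first block once the second
  block is frozen at \<open>\<tau>\<close>; it is itself a power series in
  \<open>\<tau>\<close>.\<close>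

definition section_coeff ::
  "nat \<Rightarrow> nat \<Rightarrow> ((nat \<Rightarrow> nat) \<Rightarrow> real) \<Rightarrow> (nat \<Rightarrow> real) \<Rightarrow> (nat \<Rightarrow> nat) \<Rightarrow> real" where
  "section_coeff d1 d2 a \<tau> \<beta> =
     (\<Sum>\<^sub>\<infinity>\<gamma>\<in>multi_indices {..<d2}. a (append_index d1 \<beta> \<gamma>) * monomial {..<d2} \<gamma> \<tau>)"

lemma joint_in_cube:
  "\<theta> \<in> cube d1 \<rho> \<Longrightarrow> \<tau> \<in> cube d2 \<rho> \<Longrightarrow> joint d1 \<theta> \<tau> \<in> cube (d1 + d2) \<rho>"
  unfolding joint_def cube_def vecs_def by auto

lemma prod_lessThan_add:
  fixes f :: "nat \<Rightarrow> 'a :: comm_monoid_mult"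
  shows "(\<Prod>i<m + n. f i) = (\<Prod>i<m. f i) * (\<Prod>i<n. f (m + i))"
  by (induction n) (auto simp: mult.assoc)

lemma monomial_joint:
  "monomial {..<d1 + d2} (append_index d1 \<beta> \<gamma>) (joint d1 \<theta> \<tau>) =
     monomial {..<d1} \<beta> \<theta> * monomial {..<d2} \<gamma> \<tau>"
  unfolding monomial_def prod_lessThan_add by (simp add: append_index_def joint_def)

lemma power_series_on_section:
  assumes ps: "power_series_on (d1 + d2) \<rho> a g" and \<tau>: "\<tau> \<in> cube d2 \<rho>" and "0 < \<rho>"
  shows "power_series_on d1 \<rho> (section_coeff d1 d2 a \<tau>) (\<lambda>\<theta>. g (joint d1 \<theta> \<tau>))"
proof -
  let ?I = "multi_indices {..<d1}" and ?J = "multi_indices {..<d2}"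
  let ?h = "\<lambda>\<theta> (\<beta>, \<gamma>). a (append_index d1 \<beta> \<gamma>) * monomial {..<d2} \<gamma> \<tau> * monomial {..<d1} \<beta> \<theta>"
  have h: "(?h \<theta> has_sum g (joint d1 \<theta> \<tau>)) (?I \<times> ?J)" if "\<theta> \<in> cube d1 \<rho>" for \<theta>
  proof -
    have "(?h \<theta> has_sum g (joint d1 \<theta> \<tau>)) (?I \<times> ?J) \<longleftrightarrow>
        ((\<lambda>\<alpha>. a \<alpha> * monomial {..<d1 + d2} \<alpha> (joint d1 \<theta> \<tau>)) has_sum g (joint d1 \<theta> \<tau>))
          (multi_indices {..<d1 + d2})"
    proof (rule has_sum_reindex_bij_witness[where j = "\<lambda>(\<beta>, \<gamma>). append_index d1 \<beta> \<gamma>"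
          and i = "\<lambda>\<alpha>. (\<lambda>i. if i < d1 then \<alpha> i else 0, \<lambda>i. \<alpha> (d1 + i))"])
      fix x assume "x \<in> ?I \<times> ?J"
      then show "(\<lambda>\<alpha>. (\<lambda>i. if i < d1 then \<alpha> i else 0, \<lambda>i. \<alpha> (d1 + i)))
          (case x of (\<beta>, \<gamma>) \<Rightarrow> append_index d1 \<beta> \<gamma>) = x"
        by (auto simp: append_index_def multi_indices_def fun_eq_iff)
      show "(case x of (\<beta>, \<gamma>) \<Rightarrow> append_index d1 \<beta> \<gamma>) \<in> multi_indices {..<d1 + d2}"
        using \<open>x \<in> ?I \<times> ?J\<close> by (auto simp: append_index_def multi_indices_def)
    next
      fix \<alpha> assume "\<alpha> \<in> multi_indices {..<d1 + d2}"
      then show "(\<lambda>i. if i < d1 then \<alpha> i else 0, \<lambda>i. \<alpha> (d1 + i)) \<in> ?I \<times> ?J"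
        by (auto simp: multi_indices_def)
      show "(case (\<lambda>i. if i < d1 then \<alpha> i else 0, \<lambda>i. \<alpha> (d1 + i)) of (\<beta>, \<gamma>) \<Rightarrow> append_index d1 \<beta> \<gamma>) = \<alpha>"
        by (auto simp: append_index_def)
    qed (auto simp: monomial_joint)
    then show ?thesis
      using power_series_onD[OF ps joint_in_cube[OF that \<tau>]] by simp
  qed
  have "(\<lambda>\<gamma>. a (append_index d1 \<beta> \<gamma>) * monomial {..<d2} \<gamma> \<tau>) summable_on ?J" if \<beta>: "\<beta> \<in> ?I" for \<beta>
  proof -
    \<comment> \<open>A point of the cube with no zero coordinate in the first block, so that the
      monomial in \<open>\<theta>\<close> can be divided out of the inner series.\<close>
    define \<theta> where "\<theta> = (\<lambda>i. if i < d1 then \<rho> / 2 else 0)"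
    have "\<theta> \<in> cube d1 \<rho>" "monomial {..<d1} \<beta> \<theta> \<noteq> 0"
      using \<open>0 < \<rho>\<close> by (auto simp: \<theta>_def cube_def vecs_def monomial_def)
    then show ?thesis
      using summable_on_SigmaD1[where f = "\<lambda>\<beta> \<gamma>. a (append_index d1 \<beta> \<gamma>) * monomial {..<d2} \<gamma> \<tau> * monomial {..<d1} \<beta> \<theta>",
          OF has_sum_imp_summable[OF h] \<beta>] by (simp add: summable_on_cmult_left')
  qed
  then have "((\<lambda>\<gamma>. a (append_index d1 \<beta> \<gamma>) * monomial {..<d2} \<gamma> \<tau>) has_sum section_coeff d1 d2 a \<tau> \<beta>) ?J"
    if "\<beta> \<in> ?I" for \<beta>
    unfolding section_coeff_def using that by (intro has_sum_infsum)
  then show ?thesis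
    unfolding power_series_on_def
    by (intro ballI has_sum_SigmaD[OF h]) (auto intro: has_sum_cmult_left)
qed

section \<open>Differentiation within a block of coordinates\<close>

lemma partial_funpow_joint:
  assumes "i < d1"
  shows "(\<lambda>\<theta>. (partial i ^^ n) g (joint d1 \<theta> \<tau>)) = (partial i ^^ n) (\<lambda>\<theta>. g (joint d1 \<theta> \<tau>))"
proof -
  have upd: "(joint d1 \<theta> \<tau>)(i := t) = joint d1 (\<theta>(i := t)) \<tau>" for \<theta> t
    using assms by (auto simp: joint_def)
  show ?thesis
  proof (induction n)
    case (Suc n)
    have "partial i ((partial i ^^ n) g) (joint d1 \<theta> \<tau>) =
        partial i (\<lambda>\<theta>. (partial i ^^ n) g (joint d1 \<theta> \<tau>)) \<theta>" for \<theta>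
      using assms unfolding partial_def upd by (simp add: joint_def)
    with Suc show ?case by simp
  qed simp
qed

lemma mixed_partial_joint:
  assumes "J \<subseteq> {..<d1}"
  shows "mixed_partial J \<alpha> g (joint d1 \<theta> \<tau>) = mixed_partial J \<alpha> (\<lambda>\<theta>. g (joint d1 \<theta> \<tau>)) \<theta>"
proof -
  have "(\<lambda>\<theta>. fold (\<lambda>i. partial i ^^ \<alpha> i) xs g (joint d1 \<theta> \<tau>)) =
      fold (\<lambda>i. partial i ^^ \<alpha> i) xs (\<lambda>\<theta>. g (joint d1 \<theta> \<tau>))" if "set xs \<subseteq> {..<d1}" for xs
    using that by (induction xs arbitrary: g) (auto simp: partial_funpow_joint)
  from this[of "sorted_list_of_set J"] assms finite_subset[OF assms] show ?thesis
    by (auto simp: mixed_partial_def fun_eq_iff)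
qed

text \<open>Coordinates with exponent 0 contribute the identity to the fold, and after removing them
  both sorted lists are the same.\<close>

lemma mixed_partial_superset:
  assumes "finite J'" "J \<subseteq> J'" "\<alpha> \<in> multi_indices J"
  shows "mixed_partial J' \<alpha> g = mixed_partial J \<alpha> g"
proof -
  have fold: "fold (\<lambda>i. partial i ^^ \<alpha> i) xs g = fold (\<lambda>i. partial i ^^ \<alpha> i) (filter (\<lambda>i. \<alpha> i \<noteq> 0) xs) g" for xs g
    by (induction xs arbitrary: g) auto
  have "filter (\<lambda>i. \<alpha> i \<noteq> 0) (sorted_list_of_set A) = sorted_list_of_set {i\<in>A. \<alpha> i \<noteq> 0}" if "finite A" for A
    using that by (intro sorted_distinct_set_unique sorted_filter[of id, simplified]) auto
  moreover have "{i\<in>J'. \<alpha> i \<noteq> 0} = {i\<in>J. \<alpha> i \<noteq> 0}"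
    using assms by (auto simp: multi_indices_def)
  ultimately show ?thesis
    using assms(1) finite_subset[OF assms(2,1)] unfolding mixed_partial_def by (subst (1 2) fold) simp
qed

lemma monomial_superset:
  assumes "finite J'" "J \<subseteq> J'" "\<alpha> \<in> multi_indices J"
  shows "monomial J' \<alpha> \<theta> = monomial J \<alpha> \<theta>"
  using assms unfolding monomial_def by (intro prod.mono_neutral_right) (auto simp: multi_indices_def)

subsection \<open>Taylor coefficients\<close>

text \<open>Defined through derivatives and not as a chosen coefficient family: it is then a total
  function of the random outcome, and the interchange assumptions speak directly about its
  expectation.\<close>

definition taylor_coeff ::
  "nat set \<Rightarrow> ((nat \<Rightarrow> real) \<Rightarrow> real) \<Rightarrow> (nat \<Rightarrow> real) \<Rightarrow> (nat \<Rightarrow> nat) \<Rightarrow> real" where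
  "taylor_coeff J g v \<alpha> = mixed_partial J \<alpha> g v / (\<Prod>i\<in>J. fact (\<alpha> i))"

lemma taylor_coeff_superset:
  assumes "finite J'" "J \<subseteq> J'" "\<alpha> \<in> multi_indices J"
  shows "taylor_coeff J' g v \<alpha> = taylor_coeff J g v \<alpha>"
proof -
  have "(\<Prod>i\<in>J'. fact (\<alpha> i)) = (\<Prod>i\<in>J. fact (\<alpha> i) :: real)"
    using assms by (intro prod.mono_neutral_right) (auto simp: multi_indices_def)
  then show ?thesis
    by (simp add: taylor_coeff_def mixed_partial_superset[OF assms])
qed

text \<open>Expresses the Taylor part of a smaller block through the coefficients of the larger one,
  so that \<open>F\<^sub>1\<close> and \<open>F\<^sub>m\<close> become pieces of a single
  coefficient family.\<close>

lemma taylor_part_superset: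
  assumes "finite J'" "J \<subseteq> J'"
  shows "taylor_part J k g v \<theta> =
    (\<Sum>\<alpha> \<in> {\<alpha> \<in> multi_indices J. sum \<alpha> J = k}. taylor_coeff J' g v \<alpha> * monomial J' \<alpha> \<theta>)"
  unfolding taylor_part_def
proof (intro sum.cong refl)
  fix \<alpha> assume "\<alpha> \<in> {\<alpha> \<in> multi_indices J. sum \<alpha> J = k}"
  then show "1 / (\<Prod>i\<in>J. fact (\<alpha> i)) * mixed_partial J \<alpha> g v * monomial J \<alpha> \<theta> =
      taylor_coeff J' g v \<alpha> * monomial J' \<alpha> \<theta>"
    by (simp add: taylor_coeff_superset[OF assms] monomial_superset[OF assms]) (simp add: taylor_coeff_def)
qed

lemma taylor_coeff_power_series:
  assumes "power_series_on d1 \<rho> b (\<lambda>\<theta>. g (joint d1 \<theta> \<tau>))" "0 < \<rho>" "\<alpha> \<in> multi_indices {..<d1}"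
  shows "taylor_coeff {..<d1} g (joint d1 (\<lambda>_. 0) \<tau>) \<alpha> = b \<alpha>"
  using mixed_partial_power_series[OF assms(1,2) order.refl assms(3)]
  by (simp add: taylor_coeff_def mixed_partial_joint[OF order.refl])

lemma power_series_on_cong:
  assumes ps: "power_series_on d \<rho> a g"
    and ab: "\<And>\<alpha>. \<alpha> \<in> multi_indices {..<d} \<Longrightarrow> a \<alpha> = b \<alpha>" and gh: "\<And>w. w \<in> cube d \<rho> \<Longrightarrow> g w = h w"
  shows "power_series_on d \<rho> b h"
  unfolding power_series_on_def
proof
  fix w assume w: "w \<in> cube d \<rho>"
  have "((\<lambda>\<alpha>. b \<alpha> * monomial {..<d} \<alpha> w) has_sum g w) (multi_indices {..<d})"
    by (rule has_sum_cong[THEN iffD1, OF _ power_series_onD[OF ps w]]) (simp add: ab)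
  then show "((\<lambda>\<alpha>. b \<alpha> * monomial {..<d} \<alpha> w) has_sum h w) (multi_indices {..<d})"
    by (simp add: gh[OF w])
qed

lemma power_series_on_taylor_coeff:
  assumes "power_series_on d1 \<rho> b (\<lambda>\<theta>. g (joint d1 \<theta> \<tau>))" "0 < \<rho>"
  shows "power_series_on d1 \<rho> (taylor_coeff {..<d1} g (joint d1 (\<lambda>_. 0) \<tau>)) (\<lambda>\<theta>. g (joint d1 \<theta> \<tau>))"
  by (rule power_series_on_cong[OF assms(1)]) (simp_all add: taylor_coeff_power_series[where b = b, OF assms])

lemma power_series_on_finite:
  assumes "finite S" "S \<subseteq> multi_indices {..<d}"
  shows "power_series_on d \<rho> (\<lambda>\<alpha>. if \<alpha> \<in> S then b \<alpha> else 0) (\<lambda>w. \<Sum>\<alpha>\<in>S. b \<alpha> * monomial {..<d} \<alpha> w)"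
  unfolding power_series_on_def using assms
  by (intro ballI has_sum_finite_neutralI[where B = S]) auto

text \<open>The polynomial and the zero series represent the same function, so uniqueness applies.
  This turns the vanishing of a homogeneous part identically in \<open>\<theta>\<close> into the
  vanishing of each coefficient.\<close>

lemma polynomial_coeff_eq_0:
  assumes S: "finite S" "S \<subseteq> multi_indices {..<d}"
    and zero: "\<And>w. w \<in> vecs d \<Longrightarrow> (\<Sum>\<alpha>\<in>S. b \<alpha> * monomial {..<d} \<alpha> w) = 0"
    and \<alpha>: "\<alpha> \<in> S"
  shows "b \<alpha> = 0"
proof -
  have "power_series_on d 1 (\<lambda>\<alpha>. if \<alpha> \<in> S then b \<alpha> else 0) (\<lambda>_. 0)"
    by (rule power_series_on_cong[OF power_series_on_finite[OF S]]) (auto simp: cube_def zero)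
  moreover have "power_series_on d 1 (\<lambda>_. 0) (\<lambda>_. 0)"
    by (simp add: power_series_on_def)
  ultimately have "(if \<alpha> \<in> S then b \<alpha> else 0) = 0"
    by (rule power_series_on_unique) (use S \<alpha> in auto)
  with \<alpha> show ?thesis by simp
qed

lemma power_series_on_diff:
  assumes "power_series_on d \<rho> a g" "power_series_on d \<rho> b h"
  shows "power_series_on d \<rho> (\<lambda>\<alpha>. a \<alpha> - b \<alpha>) (\<lambda>w. g w - h w)"
  unfolding power_series_on_def
proof
  fix w assume w: "w \<in> cube d \<rho>"
  show "((\<lambda>\<alpha>. (a \<alpha> - b \<alpha>) * monomial {..<d} \<alpha> w) has_sum g w - h w) (multi_indices {..<d})"
    using has_sum_add[OF power_series_onD[OF assms(1) w] has_sum_uminusI[OF power_series_onD[OF assms(2) w]]]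
    by (simp add: algebra_simps)
qed

lemma power_series_on_uminus:
  assumes "power_series_on d \<rho> a g"
  shows "power_series_on d \<rho> (\<lambda>\<alpha>. - a \<alpha>) (\<lambda>w. - g w)"
  using power_series_on_diff[of d \<rho> "\<lambda>_. 0" "\<lambda>_. 0", OF _ assms] by (simp add: power_series_on_def)

subsection \<open>Weights\<close>

definition weight :: "nat \<Rightarrow> nat \<Rightarrow> nat \<Rightarrow> (nat \<Rightarrow> nat) \<Rightarrow> nat" where
  "weight r d1 m \<alpha> = m * sum \<alpha> {..<r} + sum \<alpha> {r..<d1}"

lemma weight_add: "weight r d1 m (\<lambda>i. \<beta> i + \<gamma> i) = weight r d1 m \<beta> + weight r d1 m \<gamma>"
  by (simp add: weight_def sum.distrib algebra_simps)

lemma weight_diff: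
  assumes "\<beta> \<le> \<alpha>"
  shows "weight r d1 m \<beta> + weight r d1 m (\<lambda>i. \<alpha> i - \<beta> i) = weight r d1 m \<alpha>"
  using assms weight_add[of r d1 m \<beta> "\<lambda>i. \<alpha> i - \<beta> i"] by (simp add: le_fun_def)

text \<open>The three excluded kinds have weight at most \<open>2 * m\<close>, at most
  \<open>m + m\<close>, and exactly \<open>2 * m\<close>.\<close>

lemma excluded_imp_weight_le: "excluded r d1 m \<alpha> \<Longrightarrow> weight r d1 m \<alpha> \<le> 2 * m"
  by (auto simp: excluded_def weight_def)

text \<open>For positive \<open>m\<close> the weight bounds the total degree.\<close>

lemma finite_weight:
  assumes "r \<le> d1" "1 \<le> m"
  shows "finite {\<alpha> \<in> multi_indices {..<d1}. weight r d1 m \<alpha> = n}"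
proof (rule finite_subset)
  have "sum \<alpha> {..<d1} \<le> weight r d1 m \<alpha>" for \<alpha>
  proof -
    have "sum \<alpha> {..<d1} = sum \<alpha> {..<r} + sum \<alpha> {r..<d1}"
      using assms(1) sum.atLeastLessThan_concat[of 0 r d1 \<alpha>] by (simp add: atLeast0LessThan)
    then show ?thesis using assms(2) by (simp add: weight_def)
  qed
  then show "{\<alpha> \<in> multi_indices {..<d1}. weight r d1 m \<alpha> = n} \<subseteq>
      (\<Union>k\<le>n. {\<alpha> \<in> multi_indices {..<d1}. sum \<alpha> {..<d1} = k})"
    by auto
qed (auto intro: finite_multi_indices_sum)

section \<open>Powers and exponential of a series without terms of weight below
  \<open>m\<close>\<close>

context
  fixes r d1 m :: nat and b :: "(nat \<Rightarrow> nat) \<Rightarrow> real"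
  assumes r: "r \<le> d1" and m: "1 \<le> m"
    and low: "\<And>\<beta>. \<beta> \<in> multi_indices {..<d1} \<Longrightarrow> weight r d1 m \<beta> < m \<Longrightarrow> b \<beta> = 0"
begin

text \<open>Lowest weights add under products: in any splitting of \<open>\<alpha>\<close>, either
  the factor from \<open>b\<close> has weight below \<open>m\<close> or the remaining power lies
  below its own threshold.\<close>

lemma conv_power_eq_0:
  "\<alpha> \<in> multi_indices {..<d1} \<Longrightarrow> weight r d1 m \<alpha> < k * m \<Longrightarrow> (conv b ^^ k) conv_one \<alpha> = 0"
proof (induction k arbitrary: \<alpha>)
  case (Suc k)
  have "b \<beta> * (conv b ^^ k) conv_one (\<lambda>i. \<alpha> i - \<beta> i) = 0" if \<beta>: "\<beta> \<le> \<alpha>" for \<beta>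
  proof -
    have mem: "\<beta> \<in> multi_indices {..<d1}" "(\<lambda>i. \<alpha> i - \<beta> i) \<in> multi_indices {..<d1}"
      using Suc.prems(1) \<beta> by (auto intro: multi_indices_le simp: le_fun_def)
    have "weight r d1 m \<beta> < m \<or> weight r d1 m (\<lambda>i. \<alpha> i - \<beta> i) < k * m"
      using weight_diff[OF \<beta>, of r d1 m] Suc.prems(2) by auto
    then show ?thesis using low[OF mem(1)] Suc.IH[OF mem(2)] by auto
  qed
  then have "conv b ((conv b ^^ k) conv_one) \<alpha> = 0"
    unfolding conv_def[of b "(conv b ^^ k) conv_one"] by (intro sum.neutral) auto
  then show ?case by simp
qed simp

lemma conv_one_right: "\<alpha> \<in> multi_indices {..<d1} \<Longrightarrow> conv b conv_one \<alpha> = b \<alpha>"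
proof -
  assume \<alpha>: "\<alpha> \<in> multi_indices {..<d1}"
  have "(\<Sum>\<beta>\<le>\<alpha>. b \<beta> * conv_one (\<lambda>i. \<alpha> i - \<beta> i)) = (\<Sum>\<beta>\<in>{\<alpha>}. b \<beta> * conv_one (\<lambda>i. \<alpha> i - \<beta> i))"
    using finite_multi_indices_le[OF _ \<alpha>]
    by (intro sum.mono_neutral_right) (auto simp: conv_one_def fun_eq_iff le_fun_def intro: order.antisym)
  then show ?thesis by (simp add: conv_def conv_one_def)
qed

text \<open>Powers with \<open>k \<ge> 3\<close> start in weight \<open>3 * m\<close>, which exceeds
  \<open>2 * m\<close>, and \<open>k = 0\<close> contributes only at the zero exponent. The sum over
  \<open>k\<close> thus reduces to \<open>k = 1\<close> and \<open>k = 2\<close>.\<close>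

lemma exp_coeff_low_weight:
  assumes \<alpha>: "\<alpha> \<in> multi_indices {..<d1}" "\<alpha> \<noteq> (\<lambda>_. 0)" and wt: "weight r d1 m \<alpha> \<le> 2 * m"
  shows "exp_coeff b \<alpha> = b \<alpha> + conv b b \<alpha> / 2"
proof -
  have "(conv b ^^ k) conv_one \<alpha> / fact k = 0" if "k \<notin> {1, 2}" for k
  proof (cases "k = 0")
    case False
    then have "3 \<le> k" using that by auto
    then have "3 * m \<le> k * m" by simp
    then have "weight r d1 m \<alpha> < k * m" using wt m by linarith
    then show ?thesis using conv_power_eq_0[OF \<alpha>(1)] by simp
  qed (use \<alpha>(2) in \<open>simp add: conv_one_def\<close>)
  then have "((\<lambda>k. (conv b ^^ k) conv_one \<alpha> / fact k) has_sum (\<Sum>k\<in>{1, 2}. (conv b ^^ k) conv_one \<alpha> / fact k)) UNIV"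
    by (intro has_sum_finite_neutralI[where B = "{1, 2}"]) auto
  moreover have "conv b (conv b conv_one) \<alpha> = conv b b \<alpha>"
    unfolding conv_def[of b "conv b conv_one"] conv_def[of b b]
    by (intro sum.cong refl arg_cong2[where f = "(*)"] conv_one_right)
      (use \<alpha>(1) in \<open>auto intro: multi_indices_le simp: le_fun_def\<close>)
  ultimately show ?thesis
    unfolding exp_coeff_def using conv_one_right[OF \<alpha>(1)] by (subst infsumI) (auto simp: numeral_2_eq_2)
qed

lemma conv_low_weight:
  assumes \<alpha>: "\<alpha> \<in> multi_indices {..<d1}" "weight r d1 m \<alpha> < 2 * m"
  shows "conv b b \<alpha> = 0"
  unfolding conv_def
proof (intro sum.neutral ballI)
  fix \<beta> assume "\<beta> \<in> {..\<alpha>}"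
  then have \<beta>: "\<beta> \<le> \<alpha>" by simp
  have mem: "\<beta> \<in> multi_indices {..<d1}" "(\<lambda>i. \<alpha> i - \<beta> i) \<in> multi_indices {..<d1}"
    using \<alpha>(1) \<beta> by (auto intro: multi_indices_le simp: le_fun_def)
  have "weight r d1 m \<beta> < m \<or> weight r d1 m (\<lambda>i. \<alpha> i - \<beta> i) < m"
    using weight_diff[OF \<beta>, of r d1 m] \<alpha>(2) by linarith
  then show "b \<beta> * b (\<lambda>i. \<alpha> i - \<beta> i) = 0"
    using low mem by auto
qed

text \<open>In weight exactly \<open>2 * m\<close>, a splitting in which one factor is heavier than
  \<open>m\<close> has the other lighter than \<open>m\<close>, hence contributes 0. Only the lowest
  part of \<open>b\<close> enters these coefficients of the square.\<close>

lemma square_lowest_weight: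
  "(\<Sum>\<beta> \<in> {\<beta> \<in> multi_indices {..<d1}. weight r d1 m \<beta> = m}. b \<beta> * monomial {..<d1} \<beta> \<theta>)\<^sup>2 =
   (\<Sum>\<alpha> \<in> {\<alpha> \<in> multi_indices {..<d1}. weight r d1 m \<alpha> = 2 * m}. conv b b \<alpha> * monomial {..<d1} \<alpha> \<theta>)"
proof -
  let ?S = "\<lambda>n. {\<alpha> \<in> multi_indices {..<d1}. weight r d1 m \<alpha> = n}"
  let ?m = "\<lambda>\<alpha>. monomial {..<d1} \<alpha> \<theta>"
  note fin = finite_weight[OF r m]
  have fin_le: "finite {..\<alpha>}" if "\<alpha> \<in> multi_indices {..<d1}" for \<alpha>
    using finite_multi_indices_le[OF _ that] by simp
  have "(\<Sum>\<beta>\<in>?S m. b \<beta> * ?m \<beta>)\<^sup>2 = (\<Sum>(\<beta>, \<gamma>)\<in>?S m \<times> ?S m. (b \<beta> * ?m \<beta>) * (b \<gamma> * ?m \<gamma>))"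
    by (simp add: power2_eq_square sum_product sum.cartesian_product)
  also have "\<dots> = (\<Sum>(\<alpha>, \<beta>)\<in>Sigma (?S (2 * m)) (\<lambda>\<alpha>. {..\<alpha>}). b \<beta> * b (\<lambda>i. \<alpha> i - \<beta> i) * ?m \<alpha>)"
  \<comment> \<open>The right-hand side ranges over all splittings of \<open>\<alpha>\<close>;
    \<open>T'\<close> collects the unbalanced ones, whose terms are 0 and which have no partner on
    the left.\<close>
  proof (rule sum.reindex_bij_witness_not_neutral[where S' = "{}"
        and T' = "{(\<alpha>, \<beta>) \<in> Sigma (?S (2 * m)) (\<lambda>\<alpha>. {..\<alpha>}). weight r d1 m \<beta> \<noteq> m}"
        and j = "\<lambda>(\<beta>, \<gamma>). (\<lambda>i. \<beta> i + \<gamma> i, \<beta>)" and i = "\<lambda>(\<alpha>, \<beta>). (\<beta>, \<lambda>i. \<alpha> i - \<beta> i)"])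
    show "finite {(\<alpha>, \<beta>) \<in> Sigma (?S (2 * m)) (\<lambda>\<alpha>. {..\<alpha>}). weight r d1 m \<beta> \<noteq> m}"
      using fin fin_le by (intro finite_subset[OF _ finite_SigmaI[of "?S (2 * m)" "\<lambda>\<alpha>. {..\<alpha>}"]]) auto
  next
    fix x assume "x \<in> {(\<alpha>, \<beta>) \<in> Sigma (?S (2 * m)) (\<lambda>\<alpha>. {..\<alpha>}). weight r d1 m \<beta> \<noteq> m}"
    then obtain \<alpha> \<beta> where x: "x = (\<alpha>, \<beta>)" "\<alpha> \<in> multi_indices {..<d1}" "weight r d1 m \<alpha> = 2 * m"
        "\<beta> \<le> \<alpha>" "weight r d1 m \<beta> \<noteq> m"
      by auto
    have mem: "\<beta> \<in> multi_indices {..<d1}" "(\<lambda>i. \<alpha> i - \<beta> i) \<in> multi_indices {..<d1}"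
      using x by (auto intro: multi_indices_le simp: le_fun_def)
    have "weight r d1 m \<beta> < m \<or> weight r d1 m (\<lambda>i. \<alpha> i - \<beta> i) < m"
      using weight_diff[OF x(4), of r d1 m] x by linarith
    then show "(case x of (\<alpha>, \<beta>) \<Rightarrow> b \<beta> * b (\<lambda>i. \<alpha> i - \<beta> i) * ?m \<alpha>) = 0"
      using low[OF mem(1)] low[OF mem(2)] x by auto
  next
    fix x assume "x \<in> Sigma (?S (2 * m)) (\<lambda>\<alpha>. {..\<alpha>}) -
        {(\<alpha>, \<beta>) \<in> Sigma (?S (2 * m)) (\<lambda>\<alpha>. {..\<alpha>}). weight r d1 m \<beta> \<noteq> m}"
    then obtain \<alpha> \<beta> where x: "x = (\<alpha>, \<beta>)" "\<alpha> \<in> multi_indices {..<d1}" "weight r d1 m \<alpha> = 2 * m"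
        "\<beta> \<le> \<alpha>" "weight r d1 m \<beta> = m"
      by auto
    have mem: "\<beta> \<in> multi_indices {..<d1}" "(\<lambda>i. \<alpha> i - \<beta> i) \<in> multi_indices {..<d1}"
      using x by (auto intro: multi_indices_le simp: le_fun_def)
    then show "(case x of (\<alpha>, \<beta>) \<Rightarrow> (\<beta>, \<lambda>i. \<alpha> i - \<beta> i)) \<in> ?S m \<times> ?S m - {}"
      using weight_diff[OF x(4), of r d1 m] x by auto
    show "(case case x of (\<alpha>, \<beta>) \<Rightarrow> (\<beta>, \<lambda>i. \<alpha> i - \<beta> i) of (\<beta>, \<gamma>) \<Rightarrow> (\<lambda>i. \<beta> i + \<gamma> i, \<beta>)) = x"
      using x by (auto simp: le_fun_def)
  qed (auto simp: monomial_add weight_add le_fun_def multi_indices_def)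
  also have "\<dots> = (\<Sum>\<alpha>\<in>?S (2 * m). \<Sum>\<beta>\<le>\<alpha>. b \<beta> * b (\<lambda>i. \<alpha> i - \<beta> i) * ?m \<alpha>)"
    using fin fin_le by (intro sum.Sigma[symmetric]) auto
  finally show ?thesis by (simp add: conv_def sum_distrib_right)
qed

end

text \<open>As \<open>m\<close> is positive, weight \<open>m\<close> leaves two possibilities:
  degree one in the first block and nothing else, or degree \<open>m\<close> in the second block
  alone. These are the exponents of the two Taylor parts.\<close>

lemma taylor_parts_eq_weight_part:
  assumes "r \<le> d1" "1 \<le> m"
  shows "taylor_part {..<r} 1 g v \<theta> + taylor_part {r..<d1} m g v \<theta> =
    (\<Sum>\<beta> \<in> {\<beta> \<in> multi_indices {..<d1}. weight r d1 m \<beta> = m}.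
       taylor_coeff {..<d1} g v \<beta> * monomial {..<d1} \<beta> \<theta>)"
proof -
  let ?A = "{\<alpha> \<in> multi_indices {..<r}. sum \<alpha> {..<r} = 1}"
  let ?B = "{\<alpha> \<in> multi_indices {r..<d1}. sum \<alpha> {r..<d1} = m}"
  have "{\<beta> \<in> multi_indices {..<d1}. weight r d1 m \<beta> = m} = ?A \<union> ?B"
  proof (intro equalityI subsetI)
    fix \<beta> assume \<beta>: "\<beta> \<in> {\<beta> \<in> multi_indices {..<d1}. weight r d1 m \<beta> = m}"
    then have wt: "m * sum \<beta> {..<r} + sum \<beta> {r..<d1} = m" by (simp add: weight_def)
    show "\<beta> \<in> ?A \<union> ?B"
    proof (cases "sum \<beta> {..<r} = 0")
      case True
      then show ?thesis using \<beta> wt by (auto simp: multi_indices_def)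
    next
      case False
      have "m * sum \<beta> {..<r} \<le> m * 1" using wt by linarith
      with False assms(2) have 1: "sum \<beta> {..<r} = 1" by (simp only: mult_le_cancel1) linarith
      with wt have "\<forall>i\<in>{r..<d1}. \<beta> i = 0" by simp
      with \<beta> have "\<beta> i = 0" if "\<not> i < r" for i
        using that by (cases "i < d1") (auto simp: multi_indices_def)
      with 1 show ?thesis by (simp add: multi_indices_def)
    qed
  next
    fix \<beta> assume "\<beta> \<in> ?A \<union> ?B"
    then show "\<beta> \<in> {\<beta> \<in> multi_indices {..<d1}. weight r d1 m \<beta> = m}"
      using assms(1) by (auto simp: multi_indices_def weight_def)
  qed
  moreover have "?A \<inter> ?B = {}"
    by (auto simp: multi_indices_def)
  moreover have "finite ?A" "finite ?B"
    by (auto intro: finite_multi_indices_sum)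
  moreover have "{..<r} \<subseteq> {..<d1}" "{r..<d1} \<subseteq> {..<d1}"
    using assms(1) by auto
  ultimately show ?thesis
    by (simp add: sum.union_disjoint taylor_part_superset[of "{..<d1}"])
qed

text \<open>Weight below \<open>m\<close> rules out any exponent in the first block. The zero
  exponent is covered by \<open>g v = 0\<close>, the others by the vanishing homogeneous parts in
  the second block.\<close>

lemma low_weight_coeff_eq_0:
  assumes "r \<le> d1" and m: "1 \<le> m" and zero: "g v = 0"
    and low: "\<forall>k. 1 \<le> k \<and> k < m \<longrightarrow> (\<forall>\<theta>\<in>vecs d1. taylor_part {r..<d1} k g v \<theta> = 0)"
    and \<beta>: "\<beta> \<in> multi_indices {..<d1}" "weight r d1 m \<beta> < m"
  shows "taylor_coeff {..<d1} g v \<beta> = 0"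
proof -
  have "m * sum \<beta> {..<r} < m * 1" using \<beta>(2) unfolding weight_def by linarith
  then have *: "sum \<beta> {..<r} = 0" by (simp only: mult_less_cancel1) simp
  let ?S = "\<lambda>k. {\<alpha> \<in> multi_indices {r..<d1}. sum \<alpha> {r..<d1} = k}"
  from * \<beta> have mem: "\<beta> \<in> ?S (sum \<beta> {r..<d1})"
    by (auto simp: multi_indices_def)
  show ?thesis
  proof (cases "sum \<beta> {r..<d1} = 0")
    case True
    then have "\<beta> i = 0" for i
      using * \<beta>(1) by (cases "i < r"; cases "i < d1") (auto simp: multi_indices_def)
    then have "\<beta> = (\<lambda>_. 0)" by auto
    moreover have "mixed_partial {..<d1} (\<lambda>_. 0) g = g"
      using mixed_partial_superset[of "{..<d1}" "{}" "\<lambda>_. 0" g] by (simp add: mixed_partial_def)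
    ultimately show ?thesis
      using zero by (simp add: taylor_coeff_def)
  next
    case False
    show ?thesis
    proof (rule polynomial_coeff_eq_0[OF _ _ _ mem])
      fix \<theta> assume \<theta>: "\<theta> \<in> vecs d1"
      have "1 \<le> sum \<beta> {r..<d1}" "sum \<beta> {r..<d1} < m"
        using \<beta>(2) False unfolding weight_def by linarith+
      then have "taylor_part {r..<d1} (sum \<beta> {r..<d1}) g v \<theta> = 0"
        using low \<theta> by blast
      then show "(\<Sum>\<alpha>\<in>?S (sum \<beta> {r..<d1}). taylor_coeff {..<d1} g v \<alpha> * monomial {..<d1} \<alpha> \<theta>) = 0"
        by (subst taylor_part_superset[symmetric]) auto
    next
      show "finite (?S (sum \<beta> {r..<d1}))"
        by (rule finite_multi_indices_sum) simp
      show "?S (sum \<beta> {r..<d1}) \<subseteq> multi_indices {..<d1}"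
        by (auto simp: multi_indices_def)
    qed
  qed
qed

text \<open>An exponent in \<open>\<theta>\<close> is an exponent in all parameters that is 0 on
  \<open>\<tau>\<close>, so the interchange property specialises to the points with
  \<open>\<theta> = 0\<close>.\<close>

lemma interchangeable_taylor_coeff:
  assumes "interchangeable P (d1 + d2) g"
  shows "\<exists>\<rho>>0. \<forall>\<tau>\<in>cube d2 \<rho>. \<forall>\<alpha>\<in>multi_indices {..<d1}.
    integrable P (\<lambda>\<omega>. taylor_coeff {..<d1} (g \<omega>) (joint d1 (\<lambda>_. 0) \<tau>) \<alpha>) \<and>
    (\<integral>\<omega>. taylor_coeff {..<d1} (g \<omega>) (joint d1 (\<lambda>_. 0) \<tau>) \<alpha> \<partial>P) =
      taylor_coeff {..<d1} (\<lambda>w. \<integral>\<omega>. g \<omega> w \<partial>P) (joint d1 (\<lambda>_. 0) \<tau>) \<alpha>"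
proof -
  obtain \<rho> where \<rho>: "0 < \<rho>" "\<And>w \<alpha>. w \<in> cube (d1 + d2) \<rho> \<Longrightarrow> \<alpha> \<in> multi_indices {..<d1 + d2} \<Longrightarrow>
      integrable P (\<lambda>\<omega>. mixed_partial {..<d1 + d2} \<alpha> (g \<omega>) w) \<and>
      mixed_partial {..<d1 + d2} \<alpha> (\<lambda>w. \<integral>\<omega>. g \<omega> w \<partial>P) w =
        (\<integral>\<omega>. mixed_partial {..<d1 + d2} \<alpha> (g \<omega>) w \<partial>P)"
    using assms unfolding interchangeable_def by blast
  have mem: "joint d1 (\<lambda>_. 0) \<tau> \<in> cube (d1 + d2) \<rho>" if "\<tau> \<in> cube d2 \<rho>" for \<tau>
    using that zero_in_cube[OF \<rho>(1)] by (intro joint_in_cube)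
  have sub: "\<alpha> \<in> multi_indices {..<d1 + d2}" if "\<alpha> \<in> multi_indices {..<d1}" for \<alpha>
    using that by (auto simp: multi_indices_def)
  have eq: "mixed_partial {..<d1 + d2} \<alpha> h = mixed_partial {..<d1} \<alpha> h"
    if "\<alpha> \<in> multi_indices {..<d1}" for h \<alpha>
    using that by (intro mixed_partial_superset) auto
  show ?thesis
    by (rule exI[of _ \<rho>]) (use \<rho>(1) \<rho>(2)[OF mem sub] in \<open>auto simp: eq taylor_coeff_def\<close>)
qed

subsection \<open>The likelihood ratio\<close>

context statistical_model
begin

text \<open>The law of \<open>X\<close> has density \<open>q\<close>, so it gives no mass to the
  points where \<open>q\<close> vanishes.\<close>

lemma AE_X:
  assumes "AE x in M. 0 < q x \<longrightarrow> Q x"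
  shows "AE \<omega> in P. Q (X \<omega>)"
proof -
  have X: "X \<in> measurable P M"
    using X_density by (simp add: distributed_def)
  have "AE x in density M (\<lambda>x. ennreal (q x)). Q x"
    using assms q_measurable by (subst AE_density) auto
  then show ?thesis
    unfolding distributed_distr_eq_density[OF X_density, symmetric] by (rule AE_distrD[OF X])
qed

text \<open>Where \<open>q\<close> is positive, common support makes \<open>p\<close> positive too
  and the logarithm genuine. The exceptional null set is the same for all \<open>w\<close>, as the
  identity is later differentiated in \<open>w\<close> for a fixed outcome.\<close>

lemma lr_eq_exp_llr: "AE \<omega> in P. \<forall>w\<in>\<Theta>. p (X \<omega>) w / q (X \<omega>) = exp (- llr p q (X \<omega>) w)"
proof (rule AE_X)
  show "AE x in M. 0 < q x \<longrightarrow> (\<forall>w\<in>\<Theta>. p x w / q x = exp (- llr p q x w))"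
    using common_support by eventually_elim (auto simp: llr_def exp_minus)
qed

text \<open>Integrating against \<open>q\<close> cancels the denominator. Where \<open>q\<close> is
  0, common support forces \<open>p\<close> to be 0 as well, so no mass of \<open>p\<close> is lost
  and the total is 1.\<close>

lemma expectation_lr:
  assumes w: "w \<in> \<Theta>"
  shows "(\<integral>\<omega>. p (X \<omega>) w / q (X \<omega>) \<partial>P) = 1"
proof -
  note [measurable] = p_measurable[OF w] q_measurable
  have X[measurable]: "X \<in> measurable P M"
    using X_density by (simp add: distributed_def)
  have "(\<integral>\<^sup>+\<omega>. ennreal (p (X \<omega>) w / q (X \<omega>)) \<partial>P) = (\<integral>\<^sup>+x. ennreal (q x) * ennreal (p x w / q x) \<partial>M)"
    by (rule distributed_nn_integral[OF X_density, symmetric]) measurable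
  also have "\<dots> = (\<integral>\<^sup>+x. ennreal (p x w) \<partial>M)"
  proof (rule nn_integral_cong_AE)
    show "AE x in M. ennreal (q x) * ennreal (p x w / q x) = ennreal (p x w)"
      using common_support AE_space
    proof eventually_elim
      case (elim x)
      show ?case
      proof (cases "0 < q x")
        case True
        then show ?thesis using p_nonneg[OF elim(2) w] by (simp flip: ennreal_mult)
      next
        case False
        then show ?thesis using elim(1) w q_nonneg[OF elim(2)] p_nonneg[OF elim(2) w] by force
      qed
    qed
  qed
  finally have "(\<integral>\<^sup>+\<omega>. ennreal (p (X \<omega>) w / q (X \<omega>)) \<partial>P) = 1"
    using p_normalised[OF w] by simp
  then show ?thesis
    using measurable_space[OF X] p_nonneg[OF _ w] q_nonneg
    by (subst integral_eq_nn_integral) (auto intro!: AE_I2)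
qed

end

theorem theorem1:
  fixes P :: "'w measure" and M :: "'x measure" and X :: "'w \<Rightarrow> 'x"
    and p :: "'x \<Rightarrow> (nat \<Rightarrow> real) \<Rightarrow> real" and q :: "'x \<Rightarrow> real"
    and d1 d2 r m :: nat and \<Theta> U :: "(nat \<Rightarrow> real) set"
    and f :: "'w \<Rightarrow> (nat \<Rightarrow> real) \<Rightarrow> real"
  assumes model: "statistical_model P M X p q (d1 + d2) \<Theta>"
    and f: "f = (\<lambda>\<omega>. llr p q (X \<omega>))"
    and "1 \<le> d1" and "1 \<le> r" and "r \<le> d1" and "1 \<le> m"
    and U: "nbhd0 d2 U" "\<And>\<tau>. \<tau> \<in> U \<Longrightarrow> joint d1 (\<lambda>_. 0) \<tau> \<in> \<Theta>"
    and cond0: "d2 > 0 \<Longrightarrow> \<forall>\<tau>\<in>U. AE \<omega> in P. f \<omega> (joint d1 (\<lambda>_. 0) \<tau>) = 0"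
    and cond1: "lin_indep_rvs P r (\<lambda>i \<omega>. partial i (f \<omega>) (\<lambda>_. 0))"
    and cond2: "vanishes_below P r d1 U f m"
    and m_max: "r < d1 \<Longrightarrow> \<forall>m'. vanishes_below P r d1 U f m' \<longrightarrow> m' \<le> m"
    and m_one: "m = 1 \<longleftrightarrow> r = d1"
  shows "\<exists>\<epsilon>>0. \<exists>R c. \<forall>\<tau>\<in>cube d2 \<epsilon>.
    (\<forall>\<theta>\<in>cube d1 \<epsilon>.
       KL P X p q (joint d1 \<theta> \<tau>) =
         1 / 2 * (\<integral>\<omega>. (taylor_part {..<r} 1 (f \<omega>) (joint d1 (\<lambda>_. 0) \<tau>) \<theta>
                     + taylor_part {r..<d1} m (f \<omega>) (joint d1 (\<lambda>_. 0) \<tau>) \<theta>)\<^sup>2 \<partial>P)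
         + R \<theta> \<tau> \<and>
       ((\<lambda>\<alpha>. c \<tau> \<alpha> * monomial {..<d1} \<alpha> \<theta>) has_sum R \<theta> \<tau>) (multi_indices {..<d1})) \<and>
    (\<forall>\<alpha>\<in>multi_indices {..<d1}. excluded r d1 m \<alpha> \<longrightarrow> c \<tau> \<alpha> = 0)"
proof -
  interpret statistical_model P M X p q "d1 + d2" \<Theta> by (rule model)
  define v where "v = joint d1 (\<lambda>_. 0)"
  define lr where "lr = (\<lambda>\<omega> w. p (X \<omega>) w / q (X \<omega>))"
  let ?I = "multi_indices {..<d1}"
  let ?wt = "weight r d1 m"
  define B where "B = (\<lambda>\<tau> \<omega>. taylor_coeff {..<d1} (f \<omega>) (v \<tau>))"
  define L where "L = (\<lambda>\<tau> \<omega>. taylor_coeff {..<d1} (lr \<omega>) (v \<tau>))"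
  define \<kappa> where "\<kappa> = (\<lambda>\<tau>. taylor_coeff {..<d1} (KL P X p q) (v \<tau>))"
  have KL: "KL P X p q = (\<lambda>w. \<integral>\<omega>. f \<omega> w \<partial>P)"
    by (simp add: KL_def f fun_eq_iff)
  obtain \<rho>1 k where \<rho>1: "0 < \<rho>1" "power_series_on (d1 + d2) \<rho>1 k (KL P X p q)"
    using KL_analytic unfolding real_analytic_at_0_def power_series_on_def by blast
  obtain \<rho>2 a where \<rho>2: "0 < \<rho>2" "AE \<omega> in P. power_series_on (d1 + d2) \<rho>2 (\<lambda>\<alpha>. a \<alpha> \<omega>) (f \<omega>)"
    using llr_analytic unfolding L2_analytic_at_0_def power_series_on_def f by blast
  have "\<exists>\<rho>>0. \<forall>\<tau>\<in>cube d2 \<rho>. \<forall>\<alpha>\<in>?I.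
      integrable P (\<lambda>\<omega>. B \<tau> \<omega> \<alpha>) \<and> (\<integral>\<omega>. B \<tau> \<omega> \<alpha> \<partial>P) = \<kappa> \<tau> \<alpha>"
    unfolding B_def v_def \<kappa>_def KL by (rule interchangeable_taylor_coeff[OF llr_interchange[folded f]])
  then obtain \<rho>3 where \<rho>3: "0 < \<rho>3"
      "\<And>\<tau> \<alpha>. \<tau> \<in> cube d2 \<rho>3 \<Longrightarrow> \<alpha> \<in> ?I \<Longrightarrow> integrable P (\<lambda>\<omega>. B \<tau> \<omega> \<alpha>)"
      "\<And>\<tau> \<alpha>. \<tau> \<in> cube d2 \<rho>3 \<Longrightarrow> \<alpha> \<in> ?I \<Longrightarrow> (\<integral>\<omega>. B \<tau> \<omega> \<alpha> \<partial>P) = \<kappa> \<tau> \<alpha>"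
    by blast
  have "\<exists>\<rho>>0. \<forall>\<tau>\<in>cube d2 \<rho>. \<forall>\<alpha>\<in>?I. integrable P (\<lambda>\<omega>. L \<tau> \<omega> \<alpha>) \<and>
      (\<integral>\<omega>. L \<tau> \<omega> \<alpha> \<partial>P) = taylor_coeff {..<d1} (\<lambda>w. \<integral>\<omega>. lr \<omega> w \<partial>P) (v \<tau>) \<alpha>"
    unfolding L_def v_def by (rule interchangeable_taylor_coeff[OF lr_interchange[folded lr_def]])
  then obtain \<rho>4 where \<rho>4: "0 < \<rho>4"
      "\<And>\<tau> \<alpha>. \<tau> \<in> cube d2 \<rho>4 \<Longrightarrow> \<alpha> \<in> ?I \<Longrightarrow> integrable P (\<lambda>\<omega>. L \<tau> \<omega> \<alpha>)"
      "\<And>\<tau> \<alpha>. \<tau> \<in> cube d2 \<rho>4 \<Longrightarrow> \<alpha> \<in> ?I \<Longrightarrow>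
        (\<integral>\<omega>. L \<tau> \<omega> \<alpha> \<partial>P) = taylor_coeff {..<d1} (\<lambda>w. \<integral>\<omega>. lr \<omega> w \<partial>P) (v \<tau>) \<alpha>"
    by blast
  obtain \<rho>5 where \<rho>5: "0 < \<rho>5" "cube (d1 + d2) \<rho>5 \<subseteq> \<Theta>"
    using parameters unfolding nbhd0_def by blast
  obtain \<rho>6 where \<rho>6: "0 < \<rho>6" "cube d2 \<rho>6 \<subseteq> U"
    using U(1) unfolding nbhd0_def by blast
  \<comment> \<open>One radius for the analyticity of \<open>KL\<close> and of \<open>f\<close>,
    both interchange properties, and membership in \<Theta> and \<open>U\<close>.\<close>
  define \<epsilon> where "\<epsilon> = Min {\<rho>1, \<rho>2, \<rho>3, \<rho>4, \<rho>5, \<rho>6}"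
  have \<epsilon>: "0 < \<epsilon>" "\<epsilon> \<le> \<rho>1" "\<epsilon> \<le> \<rho>2" "\<epsilon> \<le> \<rho>3" "\<epsilon> \<le> \<rho>4" "\<epsilon> \<le> \<rho>5" "\<epsilon> \<le> \<rho>6"
    using \<rho>1(1) \<rho>2(1) \<rho>3(1) \<rho>4(1) \<rho>5(1) \<rho>6(1) by (simp_all add: \<epsilon>_def)
  let ?F = "\<lambda>\<tau> \<theta> \<omega>. taylor_part {..<r} 1 (f \<omega>) (v \<tau>) \<theta> + taylor_part {r..<d1} m (f \<omega>) (v \<tau>) \<theta>"
  let ?S = "{\<alpha> \<in> ?I. ?wt \<alpha> = 2 * m}"
  \<comment> \<open>\<open>e\<close> holds the coefficients of the quadratic main term.
    \<open>R\<close> is by definition what remains of \<open>KL\<close>, so the work lies in showing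
    that \<open>c\<close> is its coefficient family and vanishes at the excluded exponents.\<close>
  define e where "e = (\<lambda>\<tau> \<alpha>. 1 / 2 * (\<integral>\<omega>. conv (B \<tau> \<omega>) (B \<tau> \<omega>) \<alpha> \<partial>P))"
  define c where "c = (\<lambda>\<tau> \<alpha>. \<kappa> \<tau> \<alpha> - (if \<alpha> \<in> ?S then e \<tau> \<alpha> else 0))"
  define R where "R = (\<lambda>\<theta> \<tau>. KL P X p q (joint d1 \<theta> \<tau>) - 1 / 2 * (\<integral>\<omega>. (?F \<tau> \<theta> \<omega>)\<^sup>2 \<partial>P))"
  have main: "power_series_on d1 \<epsilon> (c \<tau>) (\<lambda>\<theta>. R \<theta> \<tau>) \<and> (\<forall>\<alpha>\<in>?I. excluded r d1 m \<alpha> \<longrightarrow> c \<tau> \<alpha> = 0)"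
    if \<tau>: "\<tau> \<in> cube d2 \<epsilon>" for \<tau>
  proof -
    have \<tau>U: "\<tau> \<in> U"
      using \<tau> cube_mono[OF \<epsilon>(7)] \<rho>6(2) by blast
    have in_\<Theta>: "joint d1 \<theta> \<tau> \<in> \<Theta>" if "\<theta> \<in> cube d1 \<epsilon>" for \<theta>
      using joint_in_cube[OF that \<tau>] cube_mono[OF \<epsilon>(6)] \<rho>5(2) by blast
    note int_B = \<rho>3(2)[OF cube_mono[OF \<epsilon>(4) \<tau>]] and E_B = \<rho>3(3)[OF cube_mono[OF \<epsilon>(4) \<tau>]]
    note int_L = \<rho>4(2)[OF cube_mono[OF \<epsilon>(5) \<tau>]]
    \<comment> \<open>The expected likelihood ratio is constantly 1 near the origin, so its only
      nonzero coefficient is the constant one.\<close>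
    have E_L: "(\<integral>\<omega>. L \<tau> \<omega> \<alpha> \<partial>P) = 0" if \<alpha>: "\<alpha> \<in> ?I" "\<alpha> \<noteq> (\<lambda>_. 0)" for \<alpha>
    proof -
      have "power_series_on d1 \<epsilon> conv_one (\<lambda>\<theta>. \<integral>\<omega>. lr \<omega> (joint d1 \<theta> \<tau>) \<partial>P)"
        by (rule power_series_on_cong[OF power_series_on_one refl])
          (simp add: lr_def expectation_lr in_\<Theta>)
      then have "taylor_coeff {..<d1} (\<lambda>w. \<integral>\<omega>. lr \<omega> w \<partial>P) (v \<tau>) \<alpha> = conv_one \<alpha>"
        unfolding v_def using \<epsilon>(1) \<alpha>(1)
        by (rule taylor_coeff_power_series[where g = "\<lambda>w. \<integral>\<omega>. lr \<omega> w \<partial>P"])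
      then show ?thesis
        using \<rho>4(3)[OF cube_mono[OF \<epsilon>(5) \<tau>] \<alpha>(1)] \<alpha>(2) by (simp add: conv_one_def)
    qed
    have AE_zero: "AE \<omega> in P. f \<omega> (v \<tau>) = 0"
    \<comment> \<open>Without \<tau> the point \<open>v \<tau>\<close> is the origin and
      realizability applies; an outcome with \<open>q (X \<omega>) = 0\<close> is covered by the
      conventions \<open>0 / 0 = 0\<close> and \<open>ln 0 = 0\<close>.\<close>
    proof (cases "d2 = 0")
      case True
      then have "v \<tau> = (\<lambda>_. 0)"
        using \<tau> by (auto simp: v_def joint_def cube_def vecs_def)
      with realizable show ?thesis
        by (auto simp: f llr_def elim!: eventually_mono)
    next
      case False
      with cond0 \<tau>U show ?thesis by (auto simp: v_def)
    qed
    have AE_low: "AE \<omega> in P. \<forall>k. 1 \<le> k \<and> k < m \<longrightarrow> (\<forall>\<theta>\<in>vecs d1. taylor_part {r..<d1} k (f \<omega>) (v \<tau>) \<theta> = 0)"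
      using cond2 \<tau>U unfolding vanishes_below_def v_def AE_all_countable by auto
    \<comment> \<open>Outside one null set, for all exponents at once: for a fixed outcome,
      \<open>L\<close> and \<open>exp_coeff\<close> of \<open>- B\<close> belong to the same
      function of \<open>\<theta>\<close>, so uniqueness of coefficients identifies them.\<close>
    have AE_B: "AE \<omega> in P. (\<forall>\<beta>\<in>?I. ?wt \<beta> < m \<longrightarrow> B \<tau> \<omega> \<beta> = 0) \<and>
        (\<forall>\<alpha>\<in>?I. L \<tau> \<omega> \<alpha> = exp_coeff (\<lambda>\<beta>. - B \<tau> \<omega> \<beta>) \<alpha>)"
      using \<rho>2(2) AE_zero AE_low lr_eq_exp_llr
    proof eventually_elim
      case (elim \<omega>)
      have low: "\<forall>\<beta>\<in>?I. ?wt \<beta> < m \<longrightarrow> B \<tau> \<omega> \<beta> = 0"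
        unfolding B_def using low_weight_coeff_eq_0[OF \<open>r \<le> d1\<close> \<open>1 \<le> m\<close> elim(2,3)] by blast
      have "power_series_on d1 \<epsilon> (B \<tau> \<omega>) (\<lambda>\<theta>. f \<omega> (joint d1 \<theta> \<tau>))"
        unfolding B_def v_def
        by (rule power_series_on_taylor_coeff
            [OF power_series_on_section[OF power_series_on_mono[OF elim(1) \<epsilon>(3)] \<tau> \<epsilon>(1)] \<epsilon>(1)])
      from power_series_on_exp[OF power_series_on_uminus[OF this]]
      have "power_series_on d1 \<epsilon> (exp_coeff (\<lambda>\<beta>. - B \<tau> \<omega> \<beta>)) (\<lambda>\<theta>. lr \<omega> (joint d1 \<theta> \<tau>))"
        by (rule power_series_on_cong) (use elim(4) in_\<Theta> in \<open>auto simp: lr_def f\<close>)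
      then have "L \<tau> \<omega> \<alpha> = exp_coeff (\<lambda>\<beta>. - B \<tau> \<omega> \<beta>) \<alpha>" if "\<alpha> \<in> ?I" for \<alpha>
        unfolding L_def v_def using \<epsilon>(1) that by (rule taylor_coeff_power_series[where g = "lr \<omega>"])
      with low show ?case by blast
    qed
    have meas_B: "(\<lambda>\<omega>. B \<tau> \<omega> \<beta>) \<in> borel_measurable P" if "\<beta> \<in> ?I" for \<beta>
      using int_B[OF that] by (rule borel_measurable_integrable)
    have meas_conv: "(\<lambda>\<omega>. conv (B \<tau> \<omega>) (B \<tau> \<omega>) \<alpha>) \<in> borel_measurable P" if "\<alpha> \<in> ?I" for \<alpha>
      unfolding conv_def
      by (intro borel_measurable_sum borel_measurable_times meas_B)
        (use that in \<open>auto intro: multi_indices_le simp: le_fun_def\<close>)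
    \<comment> \<open>In these weights almost surely \<open>L = - B + conv B B / 2\<close>, the
      signs cancelling in the product. Integrability of the products is inherited from
      \<open>L\<close> and \<open>B\<close>, and taking expectations with \<open>E_L\<close> yields
      \<open>\<kappa> = e\<close>.\<close>
    have conv: "integrable P (\<lambda>\<omega>. conv (B \<tau> \<omega>) (B \<tau> \<omega>) \<alpha>) \<and> \<kappa> \<tau> \<alpha> = e \<tau> \<alpha>"
      if \<alpha>: "\<alpha> \<in> ?I" "?wt \<alpha> \<le> 2 * m" "\<alpha> \<noteq> (\<lambda>_. 0)" for \<alpha>
    proof -
      have AE: "AE \<omega> in P. 2 * (L \<tau> \<omega> \<alpha> + B \<tau> \<omega> \<alpha>) = conv (B \<tau> \<omega>) (B \<tau> \<omega>) \<alpha>"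
        using AE_B
      proof eventually_elim
        case (elim \<omega>)
        have "exp_coeff (\<lambda>\<beta>. - B \<tau> \<omega> \<beta>) \<alpha> =
            - B \<tau> \<omega> \<alpha> + conv (\<lambda>\<beta>. - B \<tau> \<omega> \<beta>) (\<lambda>\<beta>. - B \<tau> \<omega> \<beta>) \<alpha> / 2"
          using elim by (intro exp_coeff_low_weight[OF \<open>r \<le> d1\<close> \<open>1 \<le> m\<close>] \<alpha>) auto
        with elim \<alpha> show ?case by (simp add: conv_def)
      qed
      have int: "integrable P (\<lambda>\<omega>. 2 * (L \<tau> \<omega> \<alpha> + B \<tau> \<omega> \<alpha>))"
        using int_L[OF \<alpha>(1)] int_B[OF \<alpha>(1)] by auto
      have "(\<integral>\<omega>. 2 * (L \<tau> \<omega> \<alpha> + B \<tau> \<omega> \<alpha>) \<partial>P) = 2 * \<kappa> \<tau> \<alpha>"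
        using int_L[OF \<alpha>(1)] int_B[OF \<alpha>(1)] E_L[OF \<alpha>(1,3)] E_B[OF \<alpha>(1)] by simp
      with AE int show ?thesis
        using integrable_cong_AE[OF _ meas_conv[OF \<alpha>(1)] AE] integral_cong_AE[OF _ meas_conv[OF \<alpha>(1)] AE]
        by (simp add: e_def)
    qed
    have wt0: "?wt (\<lambda>_. 0) = 0" by (simp add: weight_def)
    have S: "finite ?S" "\<And>\<alpha>. \<alpha> \<in> ?S \<Longrightarrow> \<alpha> \<noteq> (\<lambda>_. 0)"
      using finite_weight[OF \<open>r \<le> d1\<close> \<open>1 \<le> m\<close>] wt0 \<open>1 \<le> m\<close> by auto
    have square: "1 / 2 * (\<integral>\<omega>. (?F \<tau> \<theta> \<omega>)\<^sup>2 \<partial>P) = (\<Sum>\<alpha>\<in>?S. e \<tau> \<alpha> * monomial {..<d1} \<alpha> \<theta>)" for \<theta>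
    proof -
      have F: "?F \<tau> \<theta> \<omega> = (\<Sum>\<beta>\<in>{\<beta> \<in> ?I. ?wt \<beta> = m}. B \<tau> \<omega> \<beta> * monomial {..<d1} \<beta> \<theta>)" for \<omega>
        unfolding B_def by (rule taylor_parts_eq_weight_part) fact+
      have "(\<integral>\<omega>. (?F \<tau> \<theta> \<omega>)\<^sup>2 \<partial>P) =
          (\<integral>\<omega>. (\<Sum>\<alpha>\<in>?S. conv (B \<tau> \<omega>) (B \<tau> \<omega>) \<alpha> * monomial {..<d1} \<alpha> \<theta>) \<partial>P)"
        unfolding F
      \<comment> \<open>Only an almost sure identity: squaring the lowest part requires the
        coefficients below weight \<open>m\<close> to vanish.\<close>
      proof (rule integral_cong_AE)
        show "AE \<omega> in P. (\<Sum>\<beta>\<in>{\<beta> \<in> ?I. ?wt \<beta> = m}. B \<tau> \<omega> \<beta> * monomial {..<d1} \<beta> \<theta>)\<^sup>2 =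
            (\<Sum>\<alpha>\<in>?S. conv (B \<tau> \<omega>) (B \<tau> \<omega>) \<alpha> * monomial {..<d1} \<alpha> \<theta>)"
          using AE_B by eventually_elim (rule square_lowest_weight[OF \<open>r \<le> d1\<close> \<open>1 \<le> m\<close>], auto)
      qed (auto intro!: borel_measurable_sum borel_measurable_power borel_measurable_times meas_B meas_conv)
      also have "\<dots> = (\<Sum>\<alpha>\<in>?S. (\<integral>\<omega>. conv (B \<tau> \<omega>) (B \<tau> \<omega>) \<alpha> \<partial>P) * monomial {..<d1} \<alpha> \<theta>)"
        using conv S(2) by (subst Bochner_Integration.integral_sum) auto
      finally show ?thesis by (simp add: e_def sum_divide_distrib)
    qed
    have "power_series_on d1 \<epsilon> (\<kappa> \<tau>) (\<lambda>\<theta>. KL P X p q (joint d1 \<theta> \<tau>))"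
      unfolding \<kappa>_def v_def
      by (rule power_series_on_taylor_coeff
          [OF power_series_on_section[OF power_series_on_mono[OF \<rho>1(2) \<epsilon>(2)] \<tau> \<epsilon>(1)] \<epsilon>(1)])
    then have "power_series_on d1 \<epsilon> (c \<tau>) (\<lambda>\<theta>. R \<theta> \<tau>)"
      unfolding c_def R_def square using S(1) by (intro power_series_on_diff power_series_on_finite) auto
    moreover have "c \<tau> \<alpha> = 0" if \<alpha>: "\<alpha> \<in> ?I" "excluded r d1 m \<alpha>" for \<alpha>
    proof -
      have wt: "?wt \<alpha> \<le> 2 * m" using \<alpha>(2) by (rule excluded_imp_weight_le)
      \<comment> \<open>The constant coefficient has expectation 0 since \<open>f\<close> vanishes
        at \<open>v \<tau>\<close>; in weight \<open>2 * m\<close> the main term cancels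
        \<open>\<kappa>\<close> exactly; in between, the square has no terms, so
        \<open>\<kappa> = e = 0\<close>.\<close>
      consider "\<alpha> = (\<lambda>_. 0)" | "\<alpha> \<in> ?S" | "\<alpha> \<noteq> (\<lambda>_. 0)" "?wt \<alpha> < 2 * m"
        using wt \<alpha>(1) by fastforce
      then show ?thesis
      proof cases
        case 1
        have "AE \<omega> in P. B \<tau> \<omega> \<alpha> = 0"
          using AE_B by eventually_elim (use \<alpha>(1) wt0 1 \<open>1 \<le> m\<close> in auto)
        then have "(\<integral>\<omega>. B \<tau> \<omega> \<alpha> \<partial>P) = 0"
          by (simp add: integral_eq_zero_AE)
        then show ?thesis
          using E_B[OF \<alpha>(1)] S(2)[of \<alpha>] 1 by (auto simp: c_def)
      next
        case 2
        then show ?thesis using conv[OF \<alpha>(1) wt S(2)] by (simp add: c_def)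
      next
        case 3
        have "AE \<omega> in P. conv (B \<tau> \<omega>) (B \<tau> \<omega>) \<alpha> = 0"
          using AE_B
        proof eventually_elim
          case (elim \<omega>)
          then have low: "\<And>\<beta>. \<beta> \<in> ?I \<Longrightarrow> ?wt \<beta> < m \<Longrightarrow> B \<tau> \<omega> \<beta> = 0" by blast
          show ?case
            using \<open>r \<le> d1\<close> \<open>1 \<le> m\<close> low \<alpha>(1) 3(2) by (rule conv_low_weight)
        qed
        then have "(\<integral>\<omega>. conv (B \<tau> \<omega>) (B \<tau> \<omega>) \<alpha> \<partial>P) = 0"
          by (simp add: integral_eq_zero_AE)
        then show ?thesis
          using conv[OF \<alpha>(1) wt 3(1)] 3(2) by (simp add: c_def e_def)
      qed
    qed
    ultimately show ?thesis by blast
  qed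
  show ?thesis
  proof (rule exI[of _ \<epsilon>], intro conjI \<epsilon>(1) exI[of _ R] exI[of _ c] ballI impI)
    fix \<tau> \<theta> assume "\<tau> \<in> cube d2 \<epsilon>" "\<theta> \<in> cube d1 \<epsilon>"
    then show "((\<lambda>\<alpha>. c \<tau> \<alpha> * monomial {..<d1} \<alpha> \<theta>) has_sum R \<theta> \<tau>) ?I"
      using main power_series_onD by blast
  qed (use main in \<open>auto simp: R_def v_def\<close>)
qed

end
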